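(* Let $D$ be a positive squarefree integer with $N(\varepsilon)=-1$. For all $s\in\mathbb{C}$ away from the poles of the summands, \[ Z_D^{\mathrm{odd}}(s)=\frac{q^{s/2}}{8\,\Gamma(s)\log\varepsilon}\sum_{m\in\mathbb{Z}}(-1)^m\,\Gamma\Big(\frac s2+\frac{\pi i m}{2\log\varepsilon}\Big)\Gamma\Big(\frac s2-\frac{\pi i m}{2\log\varepsilon}\Big), \] where the series converges and agrees with the defining Dirichlet series for $\operatorname{Re}s>0$. Consequently $Z_D^{\mathrm{odd}}$ has meromorphic continuation to $\mathbb{C}$, with simple poles at $s=-2k+\frac{\pi i m}{\log\varepsilon}$ for $m\in\mathbb{Z}$ and integers $k\ge0$.
   Context: $D$ positive squarefree, $\mathcal{O}_D$ the ring of integers of $\mathbb{Q}(\sqrt D)\subset\mathbb{R}$, $\varepsilon>1$ its fundamental unit, $\overline{\varepsilon}$ its conjugate, $N$ the norm. $q=D$ if $D\equiv1\bmod4$, else $q=4D$. $F_D(n)=(\varepsilon^n-\overline{\varepsilon}^{\,n})/\sqrt q$, and $Z_D^{\mathrm{odd}}(s)=\sum_{n\ge1}F_D(2n-1)^{-s}$ for $\operatorname{Re}s>0$. *)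

theory Defs
  imports "HOL-Complex_Analysis.Complex_Analysis" "HOL-Computational_Algebra.Squarefree"
begin

text \<open>Real quadratic field Q(sqrt D) embedded in the reals. Elements of the ring of
  integers O_D are (a + b sqrt D)/2 with a, b integers, a = b mod 2 if D = 1 mod 4,
  and a, b both even otherwise.\<close>

definition in_OD :: "nat \<Rightarrow> real \<Rightarrow> bool" where
  "in_OD D x \<longleftrightarrow> (\<exists>a b :: int. x = (real_of_int a + real_of_int b * sqrt (real D)) / 2 \<and>
      (if D mod 4 = 1 then even (a - b) else even a \<and> even b))"

text \<open>Galois conjugate: (a + b sqrt D)/2 \<mapsto> (a - b sqrt D)/2 (well defined since sqrt D is
  irrational for squarefree D > 1).\<close>
definition OD_conj :: "nat \<Rightarrow> real \<Rightarrow> real" where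
  "OD_conj D x = (THE y. \<exists>a b :: int. x = (real_of_int a + real_of_int b * sqrt (real D)) / 2 \<and>
      y = (real_of_int a - real_of_int b * sqrt (real D)) / 2)"

definition OD_norm :: "nat \<Rightarrow> real \<Rightarrow> real" where
  "OD_norm D x = x * OD_conj D x"

definition OD_unit :: "nat \<Rightarrow> real \<Rightarrow> bool" where
  "OD_unit D x \<longleftrightarrow> in_OD D x \<and> (\<exists>y. in_OD D y \<and> x * y = 1)"

definition fund_unit :: "nat \<Rightarrow> real" where
  "fund_unit D = (LEAST x. OD_unit D x \<and> 1 < x)"

definition qD :: "nat \<Rightarrow> nat" where
  "qD D = (if D mod 4 = 1 then D else 4 * D)"

definition F_D :: "nat \<Rightarrow> nat \<Rightarrow> real" where
  "F_D D n = (fund_unit D ^ n - OD_conj D (fund_unit D) ^ n) / sqrt (real (qD D))"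

text \<open>Z_D^odd(s) = sum_{n>=1} F_D(2n-1)^{-s}; here indexed from n = 0 as F_D(2n+1).\<close>
definition Z_odd :: "nat \<Rightarrow> complex \<Rightarrow> complex" where
  "Z_odd D s = (\<Sum>n. complex_of_real (F_D D (2 * n + 1)) powr (- s))"

definition Z_odd_gamma_term :: "nat \<Rightarrow> complex \<Rightarrow> int \<Rightarrow> complex" where
  "Z_odd_gamma_term D s m =
     (-1) powi m *
     Gamma (s / 2 + \<i> * of_real pi * of_int m / (2 * of_real (ln (fund_unit D)))) *
     Gamma (s / 2 - \<i> * of_real pi * of_int m / (2 * of_real (ln (fund_unit D))))"

text \<open>The right-hand side: q^{s/2} / (8 Gamma(s) log eps) * sum_m ...
  (1/Gamma written as rGamma, which is entire).\<close>
definition Z_odd_cont :: "nat \<Rightarrow> complex \<Rightarrow> complex" where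
  "Z_odd_cont D s =
     of_real (real (qD D)) powr (s / 2) * rGamma s / (8 * of_real (ln (fund_unit D))) *
     (\<Sum>\<^sub>\<infinity>m\<in>(UNIV :: int set). Z_odd_gamma_term D s m)"

definition Z_odd_poles :: "nat \<Rightarrow> complex set" where
  "Z_odd_poles D = {- 2 * of_nat k + \<i> * of_real pi * of_int m / of_real (ln (fund_unit D)) | k m. True}"

end

theory Submission
  imports Defs
begin

text \<open>Since the norm of \<open>\<epsilon>\<close> is \<open>-1\<close>, writing \<open>L = ln \<epsilon>\<close> we have
  \<open>F_D(2n+1) = 2 cosh((2n+1)L) / sqrt q\<close>, so \<open>Z\<close> is half of a sum over all integers of
  \<open>(2 cosh((2n+1)L))\<^sup>-\<^sup>s\<close>, and Poisson summation applies. The Fourier transform is the Beta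
  integral \<open>\<Gamma>(a) \<Gamma>(b) / \<Gamma>(a+b) = \<integral> e\<^sup>a\<^sup>v (1 + e\<^sup>v)\<^sup>-\<^sup>a\<^sup>-\<^sup>b dv\<close> at \<open>a, b = s/2 \<plusminus> iy\<close>. Because
  \<open>|\<Gamma>(z)| \<le> \<Gamma>(Re z)\<close> for \<open>Re z > 0\<close>, the functional equation of \<open>\<Gamma>\<close> alone gives decay \<open>O(1/m\<^sup>2)\<close> of
  the terms, locally uniformly in \<open>s\<close> on the whole plane; so near any point the series is a
  finite sum plus a holomorphic tail, and a pole only comes from the two terms \<open>\<plusminus>m\<close>, which are
  equal and cannot cancel. For \<open>m = 0\<close> the double pole of \<open>\<Gamma>(s/2)\<^sup>2\<close> is reduced to a simple
  one by the zero of \<open>1/\<Gamma>(s)\<close>.\<close>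

section \<open>The Gamma function\<close>

text \<open>Take absolute values inside Euler's integral: for \<open>t > 0\<close> the modulus of
  \<open>t powr (z - 1)\<close> depends on \<open>Re z\<close> only.\<close>

lemma norm_Gamma_complex_le:
  fixes z :: complex
  assumes "Re z > 0"
  shows "norm (Gamma z) \<le> Gamma (Re z)"
proof -
  have "norm (integral {0..} (\<lambda>t. of_real t powr (z - 1) / of_real (exp t)))
          \<le> integral {0..} (\<lambda>t. t powr (Re z - 1) / exp t)"
    using Gamma_integral_complex[OF assms] Gamma_integral_real[OF assms]
    by (intro integral_norm_bound_integral)
       (auto simp: norm_divide norm_powr_real_powr integrable_on_def)
  thus ?thesis
    using Gamma_integral_complex[OF assms] Gamma_integral_real[OF assms]
    by (simp add: integral_unique)
qed

text \<open>Euler's integral after \<open>t = exp v\<close>. On the whole line with Lebesgue-Borel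
  measure, scaling \<open>t\<close> becomes translating \<open>v\<close>, and Fubini is
  available.\<close>

lemma Gamma_exp_integral:
  fixes z :: complex
  assumes "Re z > 0"
  shows "has_bochner_integral lborel
           (\<lambda>v. exp (z * of_real v - of_real (exp v))) (Gamma z)"
proof -
  let ?f = "\<lambda>t. of_real t powr (z - 1) / of_real (exp t) :: complex"
  have img: "range (exp :: real \<Rightarrow> real) = {0<..}"
    using exp_total by (fastforce simp: image_iff)
  have "(\<lambda>v. \<bar>exp v\<bar> *\<^sub>R ?f (exp v)) absolutely_integrable_on UNIV \<and>
        integral UNIV (\<lambda>v. \<bar>exp v\<bar> *\<^sub>R ?f (exp v)) = Gamma z"
    using absolutely_integrable_Gamma_integral'[OF assms] Gamma_integral_complex'[OF assms]
    by (subst has_absolute_integral_change_of_variables_real)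
       (auto simp: img integral_unique inj_on_def intro: DERIV_subset[OF DERIV_exp])
  moreover have "(\<lambda>v. \<bar>exp v\<bar> *\<^sub>R ?f (exp v)) = (\<lambda>v. exp (z * of_real v - of_real (exp v)))"
  proof
    fix v :: real
    have "of_real (exp v) powr (z - 1) = exp ((z - 1) * of_real v)"
      by (simp add: powr_def Ln_of_real exp_of_real[symmetric] del: exp_of_real)
    thus "\<bar>exp v\<bar> *\<^sub>R ?f (exp v) = exp (z * of_real v - of_real (exp v))"
      by (simp add: scaleR_conv_of_real exp_diff left_diff_distrib exp_of_real[symmetric] del: exp_of_real)
  qed
  ultimately have *: "(\<lambda>v. exp (z * of_real v - of_real (exp v))) absolutely_integrable_on UNIV"
    "integral UNIV (\<lambda>v. exp (z * of_real v - of_real (exp v))) = Gamma z"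
    by simp_all
  have m: "(\<lambda>v. exp (z * of_real v - of_real (exp v))) \<in> borel_measurable lborel"
    by measurable
  have "integrable lebesgue (\<lambda>v. exp (z * of_real v - of_real (exp v)))"
    using *(1) by (simp add: set_integrable_def)
  hence i: "integrable lborel (\<lambda>v. exp (z * of_real v - of_real (exp v)))"
    using integrable_completion[OF m] by simp
  moreover have "integral\<^sup>L lborel (\<lambda>v. exp (z * of_real v - of_real (exp v))) = Gamma z"
    using integral_lborel[OF i] *(2) by simp
  ultimately show ?thesis by (simp add: has_bochner_integral_iff)
qed

lemma Gamma_mult_integral:
  fixes a b :: complex
  assumes a: "Re a > 0" and b: "Re b > 0"
  defines "h \<equiv> \<lambda>u::real. exp (a * of_real u - (a + b) * of_real (ln (1 + exp u)))"
  shows "Gamma a * Gamma b = Gamma (a + b) * integral\<^sup>L lborel h"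
proof -
  \<comment> \<open>\<open>\<Phi>\<close> is the integrand of \<open>\<Gamma>(b) \<Gamma>(a)\<close> in the variables \<open>v\<close> and \<open>v + u\<close>; translating \<open>v\<close> by
    \<open>ln (1 + e\<^sup>u)\<close> instead splits off \<open>\<Gamma>(a + b)\<close>.\<close>
  define \<Phi> where "\<Phi> = (\<lambda>v u::real. exp ((a + b) * of_real v + a * of_real u - of_real (exp v * (1 + exp u))))"
  have shift1: "has_bochner_integral lborel (\<lambda>u. exp (z * of_real (v + u) - of_real (exp (v + u)))) (Gamma z)"
    if "Re z > 0" for z v
    using lborel_has_bochner_integral_real_affine_iff
      [of 1 "\<lambda>u. exp (z * of_real u - of_real (exp u))" "Gamma z" v] Gamma_exp_integral[OF that] by simp
  have \<Phi>1: "\<Phi> v u = exp (b * of_real v - of_real (exp v)) * exp (a * of_real (v + u) - of_real (exp (v + u)))" for v u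
    unfolding \<Phi>_def by (simp add: exp_add[symmetric] algebra_simps)
  have n1: "norm (\<Phi> v u) = exp (Re b * v - exp v) * exp (Re a * (v + u) - exp (v + u))" for v u
    unfolding \<Phi>1 by (simp add: norm_mult)
  have real_exp: "has_bochner_integral lborel (\<lambda>u. exp (x * (v + u) - exp (v + u))) (Gamma x)"
    if "x > 0" for x v :: real
  proof -
    have "has_bochner_integral lborel (\<lambda>u. of_real (exp (x * (v + u) - exp (v + u)))) (of_real (Gamma x) :: complex)"
      using shift1[of "of_real x" v] that
      by (simp only: of_real_mult[symmetric] of_real_diff[symmetric] exp_of_real Gamma_complex_of_real
            Re_complex_of_real)
    thus ?thesis using has_bochner_integral_Re by fastforce
  qed
  have [measurable]: "case_prod \<Phi> \<in> borel_measurable (lborel \<Otimes>\<^sub>M lborel)"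
    unfolding \<Phi>_def by measurable
  have int: "integrable (lborel \<Otimes>\<^sub>M lborel) (case_prod \<Phi>)"
  proof (rule lborel_pair.Fubini_integrable)
    \<comment> \<open>Integrating the modulus over \<open>u\<close> gives
      \<open>Gamma (Re a)\<close> for every \<open>v\<close>; what remains is the integrand of
      \<open>Gamma (Re b)\<close>.\<close>
    have "(\<integral>u. norm (case (v, u) of (v, u) \<Rightarrow> \<Phi> v u) \<partial>lborel) = exp (Re b * v - exp v) * Gamma (Re a)" for v
      using real_exp[OF a, of v] by (simp add: n1 has_bochner_integral_iff)
    thus "integrable lborel (\<lambda>v. \<integral>u. norm (case (v, u) of (v, u) \<Rightarrow> \<Phi> v u) \<partial>lborel)"
      using real_exp[OF b, of 0] by (simp add: has_bochner_integral_iff)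
    show "AE v in lborel. integrable lborel (\<lambda>u. case (v, u) of (v, u) \<Rightarrow> \<Phi> v u)"
      using shift1[OF a] by (auto simp: \<Phi>1 has_bochner_integral_iff)
  qed measurable
  have "(\<integral>v. (\<integral>u. \<Phi> v u \<partial>lborel) \<partial>lborel) = Gamma a * Gamma b"
    using shift1[OF a] Gamma_exp_integral[OF b] by (simp add: \<Phi>1 has_bochner_integral_iff)
  moreover have "(\<integral>v. \<Phi> v u \<partial>lborel) = Gamma (a + b) * h u" for u
  proof -
    define t where "t = ln (1 + exp u)"
    have t: "exp t = 1 + exp u" unfolding t_def by (simp add: add_pos_pos)
    have "\<Phi> v u = h u * exp ((a + b) * of_real (t + v) - of_real (exp (t + v)))" for v
      unfolding \<Phi>_def h_def t_def[symmetric] exp_add[of t] t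
      by (simp add: exp_add[symmetric] exp_diff[symmetric] algebra_simps)
    thus ?thesis using shift1[of "a + b" t] a b by (simp add: has_bochner_integral_iff)
  qed
  ultimately show ?thesis
    using lborel_pair.Fubini_integral[OF int] by simp
qed

section \<open>Sums and integrals for Poisson summation\<close>

lemma summable_on_int_symmetric:
  fixes f :: "int \<Rightarrow> real"
  assumes B: "summable B" and f: "\<And>m. 0 \<le> f m" "\<And>m. f m \<le> B (nat \<bar>m\<bar>)"
  shows "f summable_on UNIV"
proof -
  have B0: "B n \<ge> 0" for n
    using f[of "int n"] by simp
  have "B summable_on UNIV"
    using B B0 by (simp add: summable_on_UNIV_nonneg_real_iff)
  hence "(B \<circ> nat) summable_on range int" "(B \<circ> (\<lambda>m. nat (- m))) summable_on range (\<lambda>n. - int n)"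
    by (simp_all add: summable_on_reindex inj_on_def o_def)
  hence "f summable_on range int" "f summable_on range (\<lambda>n. - int n)"
    using f by (auto intro!: summable_on_comparison_test[where g = f] order.trans[OF f(2)])
  hence "f summable_on (range int \<union> range (\<lambda>n. - int n))"
    by (rule summable_on_union)
  moreover have "m \<in> range int \<union> range (\<lambda>n. - int n)" for m
    by (cases m rule: int_cases2) auto
  hence "range int \<union> range (\<lambda>n. - int n) = UNIV"
    by auto
  ultimately show ?thesis by simp
qed

text \<open>The symmetric intervals eventually contain any given finite set, so they are cofinal
  among the finite sets that define the unordered sum.\<close>

lemma symmetric_int_sums_tendsto:
  fixes a :: "int \<Rightarrow> 'a :: {topological_comm_monoid_add, t2_space}"
  assumes "(a has_sum s) UNIV"
  shows "(\<lambda>n. \<Sum>m\<in>{- int n..int n}. a m) \<longlonglongrightarrow> s"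
proof (rule filterlim_compose[OF assms[unfolded has_sum_def]])
  show "filterlim (\<lambda>n. {- int n..int n}) (finite_subsets_at_top UNIV) sequentially"
    unfolding filterlim_finite_subsets_at_top
  proof (intro allI impI)
    fix X :: "int set" assume "finite X \<and> X \<subseteq> UNIV"
    hence b: "\<bar>x\<bar> \<le> Max (insert 0 (abs ` X))" if "x \<in> X" for x
      using that by (intro Max_ge) auto
    show "\<forall>\<^sub>F n in sequentially. finite {- int n..int n} \<and> X \<subseteq> {- int n..int n} \<and> {- int n..int n} \<subseteq> UNIV"
      using eventually_ge_at_top[of "nat (Max (insert 0 (abs ` X)))"]
      by eventually_elim (use b in fastforce)
  qed
qed

text \<open>Fejer averaging only controls means of the partial sums; this identifies their limit
  once the partial sums are known to converge.\<close>

lemma Cesaro_mean_tendsto: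
  fixes x :: "nat \<Rightarrow> 'a :: real_normed_vector"
  assumes "x \<longlonglongrightarrow> l"
  shows "(\<lambda>n. (1 / real n) *\<^sub>R (\<Sum>k<n. x k)) \<longlonglongrightarrow> l"
proof (rule LIMSEQ_I)
  fix e :: real assume e: "e > 0"
  obtain N where N: "\<And>n. n \<ge> N \<Longrightarrow> norm (x n - l) < e / 2"
    using LIMSEQ_D[OF assms, of "e / 2"] e by auto
  \<comment> \<open>The terms before \<open>N\<close> contribute a fixed amount \<open>A\<close>,
    which falls below \<open>n * e / 2\<close> once \<open>n > 2 * A / e\<close>.\<close>
  define A where "A = (\<Sum>k<N. norm (x k - l))"
  obtain M' where M': "2 * A / e < real M'" using reals_Archimedean2 by blast
  define M where "M = Suc M'"
  have M: "real M > 2 * A / e" "M > 0" using M' by (auto simp: M_def)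
  show "\<exists>no. \<forall>n\<ge>no. norm ((1 / real n) *\<^sub>R (\<Sum>k<n. x k) - l) < e"
  proof (intro exI[of _ "max M N"] allI impI)
    fix n assume n: "n \<ge> max M N"
    have "norm (\<Sum>k<n. x k - l) \<le> (\<Sum>k<n. norm (x k - l))" by (rule norm_sum)
    also have "\<dots> = A + (\<Sum>k\<in>{N..<n}. norm (x k - l))"
      unfolding A_def using n by (subst sum.union_disjoint[symmetric]) (auto intro!: sum.cong)
    also have "(\<Sum>k\<in>{N..<n}. norm (x k - l)) \<le> (\<Sum>k\<in>{N..<n}. e / 2)"
      using N by (intro sum_mono less_imp_le) auto
    also have "\<dots> \<le> real n * (e / 2)" using e n by (simp add: of_nat_diff field_simps)
    finally have "norm (\<Sum>k<n. x k - l) \<le> A + real n * (e / 2)" by simp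
    moreover have "A < real n * (e / 2)"
    proof -
      have "2 * A / e < real n" using M n by linarith
      thus ?thesis using e by (simp add: field_simps)
    qed
    moreover have "(1 / real n) *\<^sub>R (\<Sum>k<n. x k) - l = (1 / real n) *\<^sub>R (\<Sum>k<n. x k - l)"
      using M n by (simp add: sum_subtractf scaleR_diff_right sum_constant_scaleR)
    ultimately show "norm ((1 / real n) *\<^sub>R (\<Sum>k<n. x k) - l) < e"
      using M n by (simp add: field_simps)
  qed
qed

text \<open>Passing from \<open>N\<close> to \<open>N + 1\<close> adds a row and a column, whose
  differences run through \<open>-N..N\<close> once each. This turns the expanded Fejer kernel into
  a sum of symmetric partial sums.\<close>

lemma double_sum_differences_eq:
  fixes a :: "int \<Rightarrow> 'a :: comm_monoid_add"
  shows "(\<Sum>j<N. \<Sum>k<N. a (int j - int k)) = (\<Sum>n<N. \<Sum>m\<in>{- int n..int n}. a m)"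
proof (induction N)
  case (Suc N)
  have "{- int N..int N} = (\<lambda>k. int N - int k) ` {..N} \<union> (\<lambda>j. int j - int N) ` {..<N}" (is "_ = ?A \<union> ?B")
  proof
    show "{- int N..int N} \<subseteq> ?A \<union> ?B"
    proof
      fix m assume "m \<in> {- int N..int N}"
      thus "m \<in> ?A \<union> ?B"
      proof (cases "m \<ge> 0")
        case True
        hence "m = int N - int (nat (int N - m))" "nat (int N - m) \<in> {..N}"
          using \<open>m \<in> {- int N..int N}\<close> by auto
        thus ?thesis by blast
      next
        case False
        hence "m = int (nat (int N + m)) - int N" "nat (int N + m) \<in> {..<N}"
          using \<open>m \<in> {- int N..int N}\<close> by auto
        thus ?thesis by blast
      qed
    qed
  qed auto
  moreover have "sum a (?A \<union> ?B) = (\<Sum>k\<le>N. a (int N - int k)) + (\<Sum>j<N. a (int j - int N))"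
    by (subst sum.union_disjoint) (auto simp: sum.reindex inj_on_def)
  ultimately have "sum a {- int N..int N} = (\<Sum>k\<le>N. a (int N - int k)) + (\<Sum>j<N. a (int j - int N))"
    by simp
  thus ?case using Suc
    by (simp add: sum.distrib lessThan_Suc_atMost[symmetric] add_ac)
qed simp

lemma integrable_exp_minus_abs:
  fixes c :: real
  assumes "c > 0"
  shows "integrable lborel (\<lambda>u. exp (- c * \<bar>u\<bar>))"
proof -
  let ?f = "\<lambda>u::real. indicator {0..} u *\<^sub>R exp (- c * u)"
  have "set_integrable lebesgue {0..} (\<lambda>u. exp (- c * u))"
    using integrable_on_exp_minus_to_infinity[OF assms] by (intro nonnegative_absolutely_integrable_1) auto
  hence 1: "integrable lborel ?f"
    unfolding set_integrable_def by (subst (asm) integrable_completion) auto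
  have 2: "integrable lborel (\<lambda>u. ?f (0 + (- 1) * u))"
    by (rule lborel_integrable_real_affine[OF 1]) simp
  show ?thesis
    \<comment> \<open>The half-line function plus its reflection is a majorant; both count the point
      0, which only enlarges it.\<close>
    by (rule Bochner_Integration.integrable_bound[OF Bochner_Integration.integrable_add[OF 1 2]])
       (auto simp: indicator_def)
qed

lemma abs_le_norm_cis_minus_one:
  fixes t :: real
  assumes "\<bar>t\<bar> \<le> 1 / 2"
  shows "\<bar>t\<bar> \<le> norm (cis (2 * pi * t) - 1)"
proof -
  define x where "x = pi * t"
  \<comment> \<open>These bounds give \<open>|x| <= 8/5\<close>, hence \<open>x^2 < 3\<close>, which
    makes the cubic Taylor remainder \<open>|x|^3 / 6\<close> at most
    \<open>|x| / 2\<close>.\<close>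
  have pi: "3 < pi" "pi < 16 / 5" using pi_gt3 pi_approx by simp_all
  have x: "\<bar>x\<bar> \<le> 8 / 5" unfolding x_def abs_mult
    using assms pi mult_mono[of "\<bar>pi\<bar>" "16/5" "\<bar>t\<bar>" "1/2"] by simp
  have "\<bar>sin x - (\<Sum>m<3. sin_coeff m * x ^ m)\<bar> \<le> inverse (fact 3) * \<bar>x\<bar> ^ 3"
    by (rule Maclaurin_sin_bound)
  also have "(\<Sum>m<3. sin_coeff m * x ^ m) = x"
    by (simp add: numeral_3_eq_3 sin_coeff_def)
  also have "inverse (fact 3) * \<bar>x\<bar> ^ 3 \<le> \<bar>x\<bar> / 2"
  proof -
    have "\<bar>x\<bar>\<^sup>2 \<le> (8/5)\<^sup>2" using x by (intro power_mono) auto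
    hence "\<bar>x\<bar> * \<bar>x\<bar>\<^sup>2 \<le> \<bar>x\<bar> * 3" by (intro mult_left_mono) (auto simp: power2_eq_square)
    thus ?thesis by (simp add: fact_numeral power3_eq_cube power2_eq_square)
  qed
  finally have "\<bar>x\<bar> \<le> 2 * \<bar>sin x\<bar>" by linarith
  moreover have "norm (cis (2 * pi * t) - 1) = 2 * \<bar>sin x\<bar>"
    using dist_exp_i_1[of "2 * pi * t"] by (simp add: cis_conv_exp x_def)
  moreover have "\<bar>t\<bar> \<le> \<bar>x\<bar>" unfolding x_def abs_mult using pi mult_right_mono[of 1 "\<bar>pi\<bar>" "\<bar>t\<bar>"] by simp
  ultimately show ?thesis by linarith
qed

text \<open>The points rounding to \<open>n\<close> form a half-open interval of length one, a whole
  number of periods of the character; the closed interval differs from it by a null set.\<close>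

lemma integral_cis_unit_interval:
  "integral\<^sup>L lborel (\<lambda>u. indicator {u. round u = n} u *\<^sub>R cis (2 * pi * of_int m * u)) = (if m = 0 then 1 else 0)"
proof -
  let ?a = "of_int n - 1/2 :: real" and ?b = "of_int n + 1/2 :: real"
  let ?f = "\<lambda>u. cis (2 * pi * of_int m * u)"
  have "integral\<^sup>L lborel (\<lambda>u. indicator {u. round u = n} u *\<^sub>R ?f u) = integral\<^sup>L lborel (\<lambda>u. indicator {?a..?b} u *\<^sub>R ?f u)"
  proof (rule integral_cong_AE)
    have "AE u in lborel. u \<noteq> ?b" by (rule AE_lborel_singleton)
    thus "AE u in lborel. indicator {u. round u = n} u *\<^sub>R ?f u = indicator {?a..?b} u *\<^sub>R ?f u"
    proof eventually_elim
      case (elim u)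
      have "round u = n \<longleftrightarrow> ?a \<le> u \<and> u < ?b" unfolding round_def by linarith
      thus ?case using elim by (auto simp: indicator_def)
    qed
    have "{u::real. round u = n} \<in> sets borel" unfolding round_def by measurable
    thus "(\<lambda>u. indicator {u. round u = n} u *\<^sub>R ?f u) \<in> borel_measurable lborel"
      by (intro borel_measurable_scaleR borel_measurable_indicator)
         (auto intro!: borel_measurable_continuous_onI continuous_intros)
    show "(\<lambda>u. indicator {?a..?b} u *\<^sub>R ?f u) \<in> borel_measurable lborel"
      by (intro borel_measurable_scaleR borel_measurable_indicator)
         (auto intro!: borel_measurable_continuous_onI continuous_intros)
  qed
  also have "\<dots> = (if m = 0 then 1 else 0)"
  proof (cases "m = 0")
    case True
    have "integral\<^sup>L lborel (\<lambda>u. indicator {?a..?b} u *\<^sub>R ?f u) = of_real ?b - of_real ?a"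
      by (rule integral_FTC_atLeastAtMost)
         (auto simp: True has_vector_derivative_def intro!: derivative_eq_intros continuous_intros 
               simp: scaleR_conv_of_real)
    thus ?thesis using True by simp
  next
    case False
    let ?F = "\<lambda>u. ?f u / (2 * pi * \<i> * of_int m)"
    have "integral\<^sup>L lborel (\<lambda>u. indicator {?a..?b} u *\<^sub>R ?f u) = ?F ?b - ?F ?a"
    proof (rule integral_FTC_atLeastAtMost)
      fix u show "(?F has_vector_derivative ?f u) (at u within {?a..?b})"
        unfolding has_vector_derivative_def using False
        by (auto intro!: derivative_eq_intros simp: scaleR_conv_of_real field_simps)
    qed (auto intro!: continuous_intros)
    also have "?f ?b = ?f ?a"
    proof -
      have "?f ?b = ?f ?a * cis (2 * pi * of_int m)"
        by (simp add: cis_mult algebra_simps)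
      thus ?thesis by simp
    qed
    finally show ?thesis using False by simp
  qed
  finally show ?thesis .
qed

section \<open>Poisson summation for exponentially decaying functions\<close>

text \<open>The geometric sum formula, kept as a product so that it also holds at integers
  \<open>u\<close>, where the ratio is 1.\<close>

lemma norm_geometric_cis_sum:
  fixes u :: real
  shows "norm (\<Sum>k<N. cis (2 * pi * real k * u)) * norm (cis (2 * pi * u) - 1) \<le> 2"
proof -
  have "(\<Sum>k<N. cis (2 * pi * real k * u)) = (\<Sum>k<N. cis (2 * pi * u) ^ k)"
    by (simp add: Complex.DeMoivre algebra_simps)
  hence "norm (\<Sum>k<N. cis (2 * pi * real k * u)) * norm (cis (2 * pi * u) - 1)
        = norm (cis (2 * pi * u) ^ N - 1)"
    by (simp add: power_diff_1_eq norm_mult mult.commute)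
  also have "\<dots> \<le> norm (cis (2 * pi * u) ^ N) + norm (1 :: complex)" by (rule norm_triangle_ineq4)
  also have "\<dots> = 2" by (simp add: norm_power)
  finally show ?thesis .
qed

lemma round_measurable [measurable]: "(\<lambda>u :: real. real_of_int (round u)) \<in> borel_measurable borel"
  unfolding round_def by measurable

lemma cis_measurable [measurable]: "(\<lambda>u. cis (a * u)) \<in> borel_measurable borel"
  by (intro borel_measurable_continuous_onI continuous_intros)

context
  fixes g g' :: "real \<Rightarrow> complex" and c C :: real
  assumes der: "\<And>u. (g has_vector_derivative g' u) (at u)"
    and c: "c > 0"
    and g_le: "\<And>u. norm (g u) \<le> C * exp (- c * \<bar>u\<bar>)"
    and g'_le: "\<And>u. norm (g' u) \<le> C * exp (- c * \<bar>u\<bar>)"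
begin

lemma C_nonneg: "C \<ge> 0"
  using order.trans[OF norm_ge_zero g_le[of 0]] by simp

lemma exp_decay_shift:
  fixes u v :: real
  assumes "\<bar>v - u\<bar> \<le> 1 / 2"
  shows "C * exp (- c * \<bar>v\<bar>) \<le> C * exp (c / 2) * exp (- c * \<bar>u\<bar>)"
proof -
  have "- c * \<bar>v\<bar> \<le> c / 2 + - c * \<bar>u\<bar>"
  proof -
    have "\<bar>u\<bar> \<le> \<bar>v\<bar> + 1 / 2" using assms by linarith
    hence "c * \<bar>u\<bar> \<le> c * (\<bar>v\<bar> + 1 / 2)" using c by (intro mult_left_mono) auto
    thus ?thesis by (simp add: algebra_simps)
  qed
  thus ?thesis
    using C_nonneg by (simp add: mult.assoc mult_exp_exp mult_left_mono)
qed

text \<open>Mean value inequality on the ball of radius 1/2 about \<open>u\<close>. The factor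
  \<open>|u - round u|\<close> will absorb one factor of the squared Dirichlet kernel.\<close>

lemma g_diff_round_le:
  "norm (g u - g (of_int (round u))) \<le> C * exp (c / 2) * exp (- c * \<bar>u\<bar>) * \<bar>u - of_int (round u)\<bar>"
proof -
  have "norm (g u - g (of_int (round u))) \<le> C * exp (c / 2) * exp (- c * \<bar>u\<bar>) * norm (u - of_int (round u))"
  proof (rule differentiable_bound[of "cball u (1/2)"])
    fix v assume v: "v \<in> cball u (1/2)"
    show "(g has_derivative (\<lambda>h. h *\<^sub>R g' v)) (at v within cball u (1/2))"
      using der[of v] unfolding has_vector_derivative_def by (rule has_derivative_at_withinI)
    have "norm (g' v) \<le> C * exp (c / 2) * exp (- c * \<bar>u\<bar>)"
      using g'_le[of v] exp_decay_shift[of v u] v by (simp add: dist_real_def abs_minus_commute)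
    hence "norm h * norm (g' v) \<le> norm h * (C * exp (c / 2) * exp (- c * \<bar>u\<bar>))" for h :: real
      by (rule mult_left_mono) simp
    thus "onorm (\<lambda>h. h *\<^sub>R g' v) \<le> C * exp (c / 2) * exp (- c * \<bar>u\<bar>)"
      by (intro onorm_le) (simp only: norm_scaleR real_norm_def mult.commute)
  qed (use of_int_round_abs_le[of u] in \<open>auto simp: dist_real_def abs_minus_commute\<close>)
  thus ?thesis by simp
qed

lemma norm_g_round_le:
  "norm (g (of_int (round u))) \<le> C * exp (c / 2) * exp (- c * \<bar>u\<bar>)"
  using order.trans[OF g_le exp_decay_shift[of "of_int (round u)" u]] of_int_round_abs_le[of u] by simp

lemma g_continuous: "continuous_on A g"
  by (meson der continuous_at_imp_continuous_on has_vector_derivative_continuous)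

lemma g_measurable [measurable]: "g \<in> borel_measurable borel"
  by (intro borel_measurable_continuous_onI g_continuous)

lemma integrable_decay: "integrable lborel (\<lambda>u. K * exp (- c * \<bar>u\<bar>))"
  by (intro integrable_mult_right integrable_exp_minus_abs c)

lemma integrable_g_cis: "integrable lborel (\<lambda>u. g u * cis (a * u))"
  by (rule Bochner_Integration.integrable_bound[OF integrable_decay[of C]])
     (use g_le in \<open>auto simp: norm_mult intro: order.trans[OF _ abs_ge_self]\<close>)

lemma integrable_g_round_cis: "integrable lborel (\<lambda>u. g (of_int (round u)) * cis (a * u))"
  by (rule Bochner_Integration.integrable_bound[OF integrable_decay[of "C * exp (c / 2)"]])
     (use norm_g_round_le in \<open>auto simp: norm_mult intro: order.trans[OF _ abs_ge_self]\<close>)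

lemma summable_g_of_int: "(\<lambda>n. g (of_int n)) summable_on UNIV"
proof -
  have "(\<lambda>n. C * exp (- c * \<bar>of_int n\<bar>)) summable_on (UNIV :: int set)"
  proof (rule summable_on_int_symmetric)
    have "summable (\<lambda>n. C * exp (- c) ^ n)"
      using c by (intro summable_mult summable_geometric) auto
    thus "summable (\<lambda>n. C * exp (- c * real n))"
      by (simp add: exp_of_nat_mult[symmetric] mult.commute)
  qed (use C_nonneg in auto)
  hence "(\<lambda>n. norm (g (of_int n))) summable_on UNIV"
    by (rule summable_on_comparison_test) (use g_le in auto)
  thus ?thesis by (rule abs_summable_summable)
qed

text \<open>The step function \<open>g (round u)\<close> is constant on each unit interval, where a
  nontrivial character integrates to 0. Subtracting it from \<open>g\<close> therefore changes only
  the coefficient at \<open>m = 0\<close>, by exactly the sum over the integers.\<close>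

lemma integral_g_round_cis:
  "integral\<^sup>L lborel (\<lambda>u. g (of_int (round u)) * cis (2 * pi * of_int m * u))
     = (if m = 0 then \<Sum>\<^sub>\<infinity>n. g (of_int n) else 0)"
proof -
  let ?e = "\<lambda>u. cis (2 * pi * of_int m * u)"
  \<comment> \<open>Truncating to \<open>|round u| <= M\<close> leaves a finite sum, which commutes
    with the integral; dominated convergence then removes the truncation.\<close>
  define G where "G M u = (\<Sum>n\<in>{- int M..int M}. g (of_int n) * (indicator {u. round u = n} u *\<^sub>R ?e u))" for M u
  have G: "G M u = (if round u \<in> {- int M..int M} then g (of_int (round u)) * ?e u else 0)" for M u
  proof -
    have "G M u = (\<Sum>n\<in>{- int M..int M}. if n = round u then g (of_int n) * ?e u else 0)"
      unfolding G_def by (intro sum.cong) (auto simp: indicator_def)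
    thus ?thesis by (simp add: sum.delta)
  qed
  have meas [measurable]: "(\<lambda>u. indicator {u :: real. round u = n} u *\<^sub>R ?e u) \<in> borel_measurable borel" for n
  proof -
    have "{u::real. round u = n} \<in> sets borel" unfolding round_def by measurable
    thus ?thesis by measurable
  qed
  have int: "integrable lborel (\<lambda>u. g (of_int n) * (indicator {u. round u = n} u *\<^sub>R ?e u))" for n
  proof (rule Bochner_Integration.integrable_bound[OF integrable_decay[of "C * exp (c / 2)"]])
    show "AE u in lborel. norm (g (of_int n) * (indicator {u. round u = n} u *\<^sub>R ?e u)) \<le> norm (C * exp (c / 2) * exp (- c * \<bar>u\<bar>))"
      using norm_g_round_le by (auto simp: norm_mult indicator_def intro: order.trans[OF _ abs_ge_self])
  qed measurable
  have "(\<lambda>M. integral\<^sup>L lborel (G M)) \<longlonglongrightarrow> integral\<^sup>L lborel (\<lambda>u. g (of_int (round u)) * ?e u)"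
  proof (rule integral_dominated_convergence[where w = "\<lambda>u. C * exp (c / 2) * exp (- c * \<bar>u\<bar>)"])
    show "AE u in lborel. (\<lambda>M. G M u) \<longlonglongrightarrow> g (of_int (round u)) * ?e u"
    proof (intro AE_I2 tendsto_eventually)
      fix u
      show "\<forall>\<^sub>F M in sequentially. G M u = g (of_int (round u)) * ?e u"
        using eventually_ge_at_top[of "nat \<bar>round u\<bar>"] by eventually_elim (auto simp: G)
    qed
    show "AE u in lborel. norm (G M u) \<le> C * exp (c / 2) * exp (- c * \<bar>u\<bar>)" for M
      using norm_g_round_le order.trans[OF norm_ge_zero norm_g_round_le] by (auto simp: G norm_mult)
    show "G M \<in> borel_measurable lborel" for M unfolding G_def by measurable
  qed (use integrable_decay in measurable)
  moreover have "integral\<^sup>L lborel (G M) = (\<Sum>n\<in>{- int M..int M}. g (of_int n) * (if m = 0 then 1 else 0))" for M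
  proof -
    have "integral\<^sup>L lborel (G M) =
        (\<Sum>n\<in>{- int M..int M}. integral\<^sup>L lborel (\<lambda>u. g (of_int n) * (indicator {u. round u = n} u *\<^sub>R ?e u)))"
      unfolding G_def by (rule Bochner_Integration.integral_sum[OF int])
    thus ?thesis by (simp only: integral_mult_right_zero integral_cis_unit_interval)
  qed
  ultimately have "(\<lambda>M. (\<Sum>n\<in>{- int M..int M}. g (of_int n) * (if m = 0 then 1 else 0)))
      \<longlonglongrightarrow> integral\<^sup>L lborel (\<lambda>u. g (of_int (round u)) * ?e u)"
    by simp
  moreover have "(\<lambda>M. (\<Sum>n\<in>{- int M..int M}. g (of_int n) * (if m = 0 then 1 else 0)))
      \<longlonglongrightarrow> (if m = 0 then \<Sum>\<^sub>\<infinity>n. g (of_int n) else 0)"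
    using symmetric_int_sums_tendsto[OF has_sum_infsum[OF summable_g_of_int]] by (cases "m = 0") auto
  ultimately show ?thesis by (rule LIMSEQ_unique)
qed

text \<open>The Fejer kernel is \<open>D\<^sup>2/N\<close> with \<open>D \<le> N\<close> and \<open>D |u - round u| \<le> 2\<close>. So the kernel times
  \<open>|u - round u|\<close> stays bounded, and tends to 0 off the integers: dominated convergence applies
  on the whole line at once.\<close>

lemma Fejer_integral_tendsto_0:
  "(\<lambda>N. integral\<^sup>L lborel (\<lambda>u. (g u - g (of_int (round u))) *
      of_real ((norm (\<Sum>k<N. cis (2 * pi * real k * u)))\<^sup>2 / real N))) \<longlonglongrightarrow> 0"
proof -
  define D where "D N u = norm (\<Sum>k<N. cis (2 * pi * real k * u))" for N and u :: real
  define r where "r u = real_of_int (round u)" for u :: real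
  have [measurable]: "D N \<in> borel_measurable borel" for N
    unfolding D_def by measurable
  have [measurable]: "r \<in> borel_measurable borel"
    unfolding r_def by measurable
  have D_N: "D N u \<le> real N" for N u
    unfolding D_def by (rule order.trans[OF norm_sum]) simp
  have D_r: "D N u * \<bar>u - r u\<bar> \<le> 2" for N u
  proof -
    have "cis (2 * pi * u) = cis (2 * pi * (u - r u)) * cis (2 * pi * r u)"
      by (simp add: cis_mult algebra_simps)
    also have "cis (2 * pi * r u) = 1" by (simp add: r_def)
    finally have "\<bar>u - r u\<bar> \<le> norm (cis (2 * pi * u) - 1)"
      using abs_le_norm_cis_minus_one[of "u - r u"] of_int_round_abs_le[of u]
      by (simp add: r_def abs_minus_commute)
    hence "D N u * \<bar>u - r u\<bar> \<le> D N u * norm (cis (2 * pi * u) - 1)"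
      by (intro mult_left_mono) (auto simp: D_def)
    also have "\<dots> \<le> 2" unfolding D_def by (rule norm_geometric_cis_sum)
    finally show ?thesis .
  qed
  let ?K = "2 * (C * exp (c / 2))"
  have "(\<lambda>N. integral\<^sup>L lborel (\<lambda>u. (g u - g (r u)) * of_real ((D N u)\<^sup>2 / real N))) \<longlonglongrightarrow> integral\<^sup>L lborel (\<lambda>u::real. 0 :: complex)"
  proof (rule integral_dominated_convergence[where w = "\<lambda>u. ?K * exp (- c * \<bar>u\<bar>)"])
    show "AE u in lborel. (\<lambda>N. (g u - g (r u)) * of_real ((D N u)\<^sup>2 / real N)) \<longlonglongrightarrow> 0"
    proof (intro AE_I2)
      fix u
      show "(\<lambda>N. (g u - g (r u)) * of_real ((D N u)\<^sup>2 / real N)) \<longlonglongrightarrow> 0"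
      proof (cases "r u = u")
        case False
        have "(\<lambda>N. (D N u)\<^sup>2 / real N) \<longlonglongrightarrow> 0"
        proof (rule Lim_null_comparison)
          have "(D N u)\<^sup>2 \<le> (2 / \<bar>u - r u\<bar>)\<^sup>2" for N
            using D_r[of N u] False by (intro power_mono) (auto simp: D_def field_simps)
          thus "\<forall>\<^sub>F N in sequentially. norm ((D N u)\<^sup>2 / real N) \<le> (2 / \<bar>u - r u\<bar>)\<^sup>2 / real N"
            by (intro always_eventually allI) (auto intro: divide_right_mono)
          show "(\<lambda>N. (2 / \<bar>u - r u\<bar>)\<^sup>2 / real N) \<longlonglongrightarrow> 0"
            by (rule lim_const_over_n)
        qed
        hence "(\<lambda>N. of_real ((D N u)\<^sup>2 / real N) :: complex) \<longlonglongrightarrow> 0"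
          using tendsto_of_real[of _ "0::real"] by (metis of_real_0)
        thus ?thesis by (intro tendsto_mult_right_zero)
      qed auto
    qed
    show "AE u in lborel. norm ((g u - g (r u)) * of_real ((D N u)\<^sup>2 / real N)) \<le> ?K * exp (- c * \<bar>u\<bar>)" for N
    proof (intro AE_I2)
      fix u
      have D0: "D N u \<ge> 0" by (simp add: D_def)
      \<comment> \<open>One factor \<open>D N u\<close> is traded for \<open>N\<close>; for
        \<open>N = 0\<close> the quotient is 0 by convention.\<close>
      have "(D N u)\<^sup>2 / real N \<le> D N u"
        using D_N[of N u] D0 mult_left_mono[OF D_N D0, of N u] by (cases "N = 0") (auto simp: power2_eq_square field_simps)
      hence "norm ((g u - g (r u)) * of_real ((D N u)\<^sup>2 / real N))
          \<le> (C * exp (c / 2) * exp (- c * \<bar>u\<bar>) * \<bar>u - r u\<bar>) * D N u"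
        unfolding norm_mult norm_of_real using g_diff_round_le[of u]
        by (intro mult_mono) (auto simp: r_def intro: order.trans[OF norm_ge_zero])
      also have "\<dots> = (C * exp (c / 2) * exp (- c * \<bar>u\<bar>)) * (D N u * \<bar>u - r u\<bar>)" by simp
      also have "\<dots> \<le> (C * exp (c / 2) * exp (- c * \<bar>u\<bar>)) * 2"
        using D_r[of N u] order.trans[OF norm_ge_zero norm_g_round_le, of u] by (intro mult_left_mono)
      finally show "norm ((g u - g (r u)) * of_real ((D N u)\<^sup>2 / real N)) \<le> ?K * exp (- c * \<bar>u\<bar>)" by (simp add: mult_ac)
    qed
  qed (use integrable_decay in measurable)
  thus ?thesis by (simp add: D_def r_def)
qed

text \<open>Let \<open>d m\<close> be the Fourier coefficients of \<open>g\<close> minus its step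
  function. The Cesaro means of their symmetric partial sums are the Fejer integrals, which tend to
  0. Summability of \<open>ghat\<close> makes the same means tend to the difference of the two
  sides.\<close>

lemma Poisson_summation:
  defines "ghat \<equiv> \<lambda>m. integral\<^sup>L lborel (\<lambda>u. g u * cis (2 * pi * of_int m * u))"
  assumes "ghat summable_on UNIV"
  shows "(\<Sum>\<^sub>\<infinity>n. g (of_int n)) = (\<Sum>\<^sub>\<infinity>m. ghat m)"
proof -
  let ?S = "\<Sum>\<^sub>\<infinity>n. g (of_int n)"
  let ?F = "\<lambda>N u. of_real ((norm (\<Sum>k<N. cis (2 * pi * real k * u)))\<^sup>2 / real N) :: complex"
  define d where "d m = ghat m - (if m = 0 then ?S else 0)" for m
  have d: "d m = integral\<^sup>L lborel (\<lambda>u. (g u - g (of_int (round u))) * cis (2 * pi * of_int m * u))" for m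
    unfolding d_def ghat_def integral_g_round_cis[symmetric]
    using integrable_g_cis integrable_g_round_cis
    by (simp add: left_diff_distrib Bochner_Integration.integral_diff)
  have int: "integrable lborel (\<lambda>u. (g u - g (of_int (round u))) * cis (a * u))" for a
    using integrable_g_cis[of a] integrable_g_round_cis[of a] by (simp add: left_diff_distrib)
  \<comment> \<open>The squared modulus is the exponential sum times its conjugate, so only the
    differences \<open>j - k\<close> occur as frequencies.\<close>
  have F: "?F N u = (\<Sum>j<N. \<Sum>k<N. cis (2 * pi * of_int (int j - int k) * u)) / of_nat N" for N u
  proof -
    have "?F N u = (\<Sum>k<N. cis (2 * pi * real k * u)) * cnj (\<Sum>k<N. cis (2 * pi * real k * u)) / of_nat N"
      by (simp only: of_real_divide complex_norm_square of_real_of_nat_eq)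
    thus ?thesis
      by (simp add: sum_product cis_cnj cis_mult) (simp add: algebra_simps)
  qed
  have "integral\<^sup>L lborel (\<lambda>u. (g u - g (of_int (round u))) * ?F N u)
      = (\<Sum>j<N. \<Sum>k<N. d (int j - int k)) / of_nat N" for N
    unfolding F d using int
    by (simp add: sum_distrib_left Bochner_Integration.integral_sum)
  hence "(\<lambda>N. (\<Sum>j<N. \<Sum>k<N. d (int j - int k)) / of_nat N) \<longlonglongrightarrow> 0"
    using Fejer_integral_tendsto_0 by presburger
  hence "(\<lambda>N. (1 / real N) *\<^sub>R (\<Sum>n<N. \<Sum>m\<in>{- int n..int n}. d m)) \<longlonglongrightarrow> 0"
    unfolding double_sum_differences_eq by (simp add: scaleR_conv_of_real divide_inverse mult.commute)
  moreover have "(\<lambda>n. \<Sum>m\<in>{- int n..int n}. d m) \<longlonglongrightarrow> (\<Sum>\<^sub>\<infinity>m. ghat m) - ?S"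
  proof -
    have "(\<Sum>m\<in>{- int n..int n}. d m) = (\<Sum>m\<in>{- int n..int n}. ghat m) - ?S" for n
      by (simp add: d_def sum_subtractf sum.delta)
    thus ?thesis
      using symmetric_int_sums_tendsto[OF has_sum_infsum[OF assms(2)]] by (simp add: tendsto_diff)
  qed
  hence "(\<lambda>N. (1 / real N) *\<^sub>R (\<Sum>n<N. \<Sum>m\<in>{- int n..int n}. d m)) \<longlonglongrightarrow> (\<Sum>\<^sub>\<infinity>m. ghat m) - ?S"
    by (rule Cesaro_mean_tendsto)
  ultimately have "(\<Sum>\<^sub>\<infinity>m. ghat m) - ?S = 0" by (rule LIMSEQ_unique[rotated])
  thus ?thesis by simp
qed

end

section \<open>The fundamental unit\<close>

text \<open>A prime \<open>p\<close> dividing \<open>D\<close> divides it exactly once, so for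
  nonzero \<open>n\<close> its multiplicity would be even on the left and odd on the right.\<close>

lemma squarefree_times_square_eq_square:
  fixes D m n :: nat
  assumes D: "squarefree D" "D > 1" and eq: "m\<^sup>2 = D * n\<^sup>2"
  shows "n = 0"
proof (rule ccontr)
  assume n: "n \<noteq> 0"
  have m: "m \<noteq> 0" using eq D n by (metis mult_eq_0_iff not_one_less_zero zero_eq_power2)
  obtain p where p: "prime p" "p dvd D" using D prime_factor_nat[of D] by auto
  have "\<not> p\<^sup>2 dvd D" using D p unfolding squarefree_def by (metis not_prime_unit)
  hence "multiplicity p D = 1" using p D by (intro multiplicity_eqI) (auto simp: power2_eq_square)
  moreover have "multiplicity p (m\<^sup>2) = multiplicity p (D * n\<^sup>2)" by (simp only: eq)
  ultimately have "2 * multiplicity p m = 1 + 2 * multiplicity p n"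
    using p m n D
    by (simp add: prime_elem_multiplicity_mult_distrib prime_elem_multiplicity_power_distrib)
  thus False by presburger
qed

lemma sqrt_squarefree_independent:
  fixes a b c d :: int
  assumes D: "squarefree D" "D > 1"
    and eq: "of_int a + of_int b * sqrt (real D) = of_int c + of_int d * sqrt (real D)"
  shows "a = c \<and> b = d"
proof -
  have "of_int (a - c) = of_int (d - b) * sqrt (real D)"
    using eq by (simp add: algebra_simps)
  hence "(of_int (a - c))\<^sup>2 = (of_int (d - b) * sqrt (real D))\<^sup>2" by simp
  hence "real_of_int ((a - c)\<^sup>2) = real_of_int (int D * (d - b)\<^sup>2)"
    by (simp add: power_mult_distrib)
  hence "(a - c)\<^sup>2 = int D * (d - b)\<^sup>2" by (simp only: of_int_eq_iff)
  hence "int ((nat \<bar>a - c\<bar>)\<^sup>2) = int (D * (nat \<bar>d - b\<bar>)\<^sup>2)" by simp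
  hence "(nat \<bar>a - c\<bar>)\<^sup>2 = D * (nat \<bar>d - b\<bar>)\<^sup>2" by (simp only: of_nat_eq_iff)
  from squarefree_times_square_eq_square[OF D this] have "b = d" by simp
  thus ?thesis using eq by simp
qed

lemma OD_conj_eq:
  assumes D: "squarefree D" "D > 1"
  shows "OD_conj D ((of_int a + of_int b * sqrt (real D)) / 2) = (of_int a - of_int b * sqrt (real D)) / 2"
  unfolding OD_conj_def
proof (rule the_equality)
  fix y
  assume "\<exists>a' b' :: int. (of_int a + of_int b * sqrt (real D)) / 2 = (of_int a' + of_int b' * sqrt (real D)) / 2 \<and>
             y = (of_int a' - of_int b' * sqrt (real D)) / 2"
  then obtain a' b' :: int where *: "(of_int a + of_int b * sqrt (real D)) / 2 = (of_int a' + of_int b' * sqrt (real D)) / 2"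
    "y = (of_int a' - of_int b' * sqrt (real D)) / 2" by blast
  hence "of_int a + of_int b * sqrt (real D) = of_int a' + of_int b' * sqrt (real D)"
    by (subst (asm) divide_cancel_right) simp
  with sqrt_squarefree_independent[OF D] * show "y = (of_int a - of_int b * sqrt (real D)) / 2" by blast
qed auto

text \<open>With the denominators 2 cleared, the norms of \<open>x\<close> and of its inverse are
  integers with product 16. Thus \<open>2 * x * (a - b sqrt D)\<close> is at most 16 in modulus, and
  \<open>x > 1\<close>. The bound 8 is crude but serves only for finiteness.\<close>

lemma OD_unit_conj_bound:
  assumes D: "squarefree D" "D > 1" and x: "OD_unit D x" "1 < x"
  obtains a b :: int where "x = (of_int a + of_int b * sqrt (real D)) / 2"
    "\<bar>of_int a - of_int b * sqrt (real D)\<bar> \<le> 8"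
proof -
  let ?r = "sqrt (real D)"
  obtain a b c d :: int where x_eq: "x = (of_int a + of_int b * ?r) / 2"
    and inv: "x * ((of_int c + of_int d * ?r) / 2) = 1"
    using x(1) unfolding OD_unit_def in_OD_def by blast
  have "of_int a + of_int b * ?r = 2 * x" using x_eq by simp
  moreover have "x * (of_int c + of_int d * ?r) = 2" using inv by (simp only: times_divide_eq_right)
  ultimately have "(of_int a + of_int b * ?r) * (of_int c + of_int d * ?r) = 4"
    by (simp add: mult.assoc)
  hence "of_int (a * c + b * d * int D) + of_int (a * d + b * c) * ?r = of_int 4 + of_int 0 * ?r"
    by (simp add: algebra_simps)
  hence "a * c + b * d * int D = 4 \<and> a * d + b * c = 0"
    by (rule sqrt_squarefree_independent[OF D])
  \<comment> \<open>Brahmagupta's identity, that is, multiplicativity of the norm.\<close>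
  moreover have "(a\<^sup>2 - int D * b\<^sup>2) * (c\<^sup>2 - int D * d\<^sup>2) = (a * c + b * d * int D)\<^sup>2 - int D * (a * d + b * c)\<^sup>2"
    by (simp add: power2_eq_square algebra_simps)
  ultimately have "(a\<^sup>2 - int D * b\<^sup>2) * (c\<^sup>2 - int D * d\<^sup>2) = 16"
    by simp
  hence dvd: "a\<^sup>2 - int D * b\<^sup>2 dvd 16" by (metis dvd_triv_left)
  hence "\<bar>a\<^sup>2 - int D * b\<^sup>2\<bar> \<le> 16" using zdvd_imp_le[of "\<bar>a\<^sup>2 - int D * b\<^sup>2\<bar>" 16] by simp
  hence "\<bar>of_int (a\<^sup>2 - int D * b\<^sup>2)\<bar> \<le> (16 :: real)" by linarith
  also have "of_int (a\<^sup>2 - int D * b\<^sup>2) = 2 * (x * (of_int a - of_int b * ?r))"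
    by (simp add: x_eq algebra_simps power2_eq_square)
  finally have "x * \<bar>of_int a - of_int b * ?r\<bar> \<le> 8" using x(2) by (simp add: abs_mult)
  moreover have "1 * \<bar>of_int a - of_int b * ?r\<bar> \<le> x * \<bar>of_int a - of_int b * ?r\<bar>"
    using x(2) by (intro mult_right_mono) auto
  ultimately have "\<bar>of_int a - of_int b * ?r\<bar> \<le> 8" by simp
  with x_eq that show thesis by blast
qed

lemma finite_OD_units_le:
  assumes D: "squarefree D" "D > 1"
  shows "finite {x. OD_unit D x \<and> 1 < x \<and> x \<le> X}"
proof -
  let ?r = "sqrt (real D)"
  \<comment> \<open>Both \<open>a\<close> and \<open>b sqrt D\<close> are \<open>x\<close> plus or
    minus half of a number bounded by 8, hence at most \<open>X + 4\<close> in modulus.\<close>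
  define K where "K = \<lceil>X + 4\<rceil>"
  let ?f = "\<lambda>(a, b). (of_int a + of_int b * ?r) / 2"
  have "{x. OD_unit D x \<and> 1 < x \<and> x \<le> X} \<subseteq> ?f ` ({-K..K} \<times> {-K..K})"
  proof clarify
    fix x assume x: "OD_unit D x" "1 < x" "x \<le> X"
    obtain a b :: int where ab: "x = (of_int a + of_int b * ?r) / 2" "\<bar>of_int a - of_int b * ?r\<bar> \<le> 8"
      by (rule OD_unit_conj_bound[OF D x(1,2)])
    have a: "\<bar>of_int a\<bar> \<le> X + 4" and br: "\<bar>of_int b * ?r\<bar> \<le> X + 4"
      using ab x by (auto simp: abs_le_iff)
    have "\<bar>of_int b\<bar> \<le> \<bar>of_int b * ?r\<bar>"
      using D mult_left_mono[of 1 ?r "\<bar>of_int b\<bar>"] by (simp add: abs_mult)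
    with a br have "\<bar>a\<bar> \<le> K" "\<bar>b\<bar> \<le> K" unfolding K_def by linarith+
    thus "x \<in> ?f ` ({-K..K} \<times> {-K..K})" using ab by force
  qed
  thus ?thesis by (rule finite_subset) auto
qed

text \<open>The number and its conjugate have product -1, so up to sign they are mutually inverse.
  They cannot both have modulus 1, so one of them or of their negatives exceeds 1.\<close>

lemma OD_unit_exists_if_norm_minus_one:
  assumes D: "squarefree D" "D > 1" and x: "OD_norm D ((of_int a + of_int b * sqrt (real D)) / 2) = - 1"
  shows "\<exists>u. OD_unit D u \<and> 1 < u"
proof -
  let ?r = "sqrt (real D)"
  define f where "f a b = (of_int a + of_int b * ?r) / 2" for a b :: int
  have prod: "f a b * f a (- b) = - 1"
    using x unfolding OD_norm_def OD_conj_eq[OF D] by (simp add: f_def)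
  have "real_of_int (a\<^sup>2 - int D * b\<^sup>2) = 4 * (f a b * f a (- b))"
    by (simp add: f_def algebra_simps power2_eq_square)
  also have "\<dots> = of_int (- 4)" unfolding prod by simp
  finally have eq: "a\<^sup>2 = int D * b\<^sup>2 - 4" by (simp only: of_int_eq_iff)
  \<comment> \<open>Integrality is read off from \<open>a^2 = D b^2 - 4\<close> modulo 4: squares
    are 0 or 1 there, and a squarefree \<open>D\<close> is not 0.\<close>
  have par: "if D mod 4 = 1 then even (a - b) else even a \<and> even b"
  proof -
    have D4: "int D mod 4 \<noteq> 0"
    proof
      assume "int D mod 4 = 0"
      hence "4 dvd D" by presburger
      hence "(2::nat)\<^sup>2 dvd D" by simp
      with D(1) have "(2::nat) dvd 1" unfolding squarefree_def by blast
      thus False by simp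
    qed
    have sq: "n\<^sup>2 mod 4 = (if even n then 0 else 1)" for n :: int
    proof (cases "even n")
      case True
      then obtain k where "n = 2 * k" by (rule evenE)
      thus ?thesis by simp
    next
      case False
      then obtain k where "n = 2 * k + 1" by (rule oddE)
      hence "n\<^sup>2 = 1 + (k\<^sup>2 + k) * 4" by (simp add: power2_eq_square algebra_simps)
      hence "n\<^sup>2 mod 4 = 1" by (simp only: mod_mult_self1) simp
      thus ?thesis using False by simp
    qed
    have "a\<^sup>2 mod 4 = ((int D mod 4) * (b\<^sup>2 mod 4)) mod 4"
      unfolding eq by (simp add: mod_simps)
    hence "(if even a then 0 else 1) = ((int D mod 4) * (if even b then 0 else 1)) mod 4"
      by (simp only: sq)
    moreover have "int D mod 4 = 1 \<or> int D mod 4 = 2 \<or> int D mod 4 = 3" using D4 by presburger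
    moreover have "D mod 4 = 1 \<longleftrightarrow> int D mod 4 = 1" by presburger
    ultimately show ?thesis by (auto split: if_splits)
  qed
  have f_in: "in_OD D (f a b)" "in_OD D (f a (- b))" "in_OD D (f (- a) b)" "in_OD D (f (- a) (- b))"
    unfolding in_OD_def f_def using par
    by (intro exI[of _ a] exI[of _ "- a"] exI[of _ b] exI[of _ "- b"]; force split: if_splits)+
  have prod': "f a b * f (- a) b = 1" "f a (- b) * f (- a) (- b) = 1"
    using prod by (auto simp: f_def algebra_simps)
  hence units: "OD_unit D (f a b)" "OD_unit D (f a (- b))" "OD_unit D (f (- a) b)" "OD_unit D (f (- a) (- b))"
    using f_in unfolding OD_unit_def by (metis mult.commute)+
  have neg: "f (- a) (- b) = - f a b" "f (- a) b = - f a (- b)" by (auto simp: f_def field_simps)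
  have "\<bar>f a b\<bar> * \<bar>f a (- b)\<bar> = 1" using prod by (simp add: abs_mult[symmetric])
  moreover have "\<bar>f a b\<bar> \<noteq> 1 \<or> \<bar>f a (- b)\<bar> \<noteq> 1"
  proof (rule ccontr)
    assume "\<not> ?thesis"
    hence "\<bar>f a b\<bar> = 1" "\<bar>f a (- b)\<bar> = 1" by auto
    \<comment> \<open>Two numbers of modulus 1 with product -1 are opposite, which forces
      \<open>a = 0\<close> and \<open>D b^2 = 4\<close>, impossible for squarefree
      \<open>D > 1\<close>.\<close>
    hence *: "f a b = - f a (- b)" using prod by (auto simp: abs_if split: if_splits)
    have "f a b + f a (- b) = of_int a" unfolding f_def by (simp add: add_divide_distrib[symmetric])
    hence "a = 0" using * by simp
    hence "int D * b\<^sup>2 = 2\<^sup>2" using eq by simp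
    hence "int (2\<^sup>2) = int (D * (nat \<bar>b\<bar>)\<^sup>2)" by simp
    hence "2\<^sup>2 = D * (nat \<bar>b\<bar>)\<^sup>2" by (simp only: of_nat_eq_iff)
    from squarefree_times_square_eq_square[OF D this] show False using eq \<open>a = 0\<close> by simp
  qed
  ultimately have "\<bar>f a b\<bar> > 1 \<or> \<bar>f a (- b)\<bar> > 1"
    using mult_left_mono[of "\<bar>f a (- b)\<bar>" 1 "\<bar>f a b\<bar>"] mult_right_mono[of "\<bar>f a b\<bar>" 1 "\<bar>f a (- b)\<bar>"]
    by (simp only: mult_1_left mult_1_right abs_ge_zero simp_thms) argo
  thus ?thesis using units neg by (auto simp: abs_if split: if_splits)
qed

text \<open>No solution of Pell's equation is needed: without a unit above 1, the \<open>LEAST\<close> in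
  \<open>fund_unit\<close> would be \<open>THE x. False\<close>. That junk number cannot be its own conjugate, since then
  its norm would be a square, so it has the form \<open>(a + b sqrt D)/2\<close>; but norm \<open>-1\<close> makes any
  such number a unit.\<close>

lemma fund_unit_norm_minus_one:
  assumes D: "squarefree D" "D > 1" and norm: "OD_norm D (fund_unit D) = - 1"
  shows "fund_unit D > 1" and "OD_conj D (fund_unit D) = - 1 / fund_unit D"
proof -
  have ex: "\<exists>u. OD_unit D u \<and> 1 < u"
  proof (rule ccontr)
    assume none: "\<nexists>u. OD_unit D u \<and> 1 < u"
    hence c: "fund_unit D = (THE x. False)"
      unfolding fund_unit_def Least_def by (intro arg_cong[where f = The] ext) auto
    show False
    proof (cases "\<exists>a b :: int. fund_unit D = (of_int a + of_int b * sqrt (real D)) / 2")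
      case True
      thus False using OD_unit_exists_if_norm_minus_one[OF D] norm none by metis
    next
      case False
      hence "OD_conj D (fund_unit D) = (THE x. False)" unfolding OD_conj_def by simp
      hence "fund_unit D * fund_unit D = - 1" using norm c by (simp add: OD_norm_def)
      thus False using zero_le_square[of "fund_unit D"] by linarith
    qed
  qed
  then obtain u where u: "OD_unit D u" "1 < u" by blast
  let ?S = "{x. OD_unit D x \<and> 1 < x \<and> x \<le> u}"
  \<comment> \<open>The reals are not well-ordered, so the least unit is found as the minimum of the
    finite set of units up to \<open>u\<close>.\<close>
  have "fund_unit D = Min ?S"
    unfolding fund_unit_def
  proof (rule Least_equality)
    have "Min ?S \<in> ?S" using u by (intro Min_in finite_OD_units_le[OF D]) auto
    thus "OD_unit D (Min ?S) \<and> 1 < Min ?S" by auto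
    fix y assume y: "OD_unit D y \<and> 1 < y"
    have "Min ?S \<le> u" using u by (intro Min_le finite_OD_units_le[OF D]) auto
    moreover have "Min ?S \<le> y" if "y \<le> u" using y that by (intro Min_le finite_OD_units_le[OF D]) auto
    ultimately show "Min ?S \<le> y" by linarith
  qed
  moreover have "Min ?S \<in> ?S" using u by (intro Min_in finite_OD_units_le[OF D]) auto
  ultimately show 1: "fund_unit D > 1" by auto
  show "OD_conj D (fund_unit D) = - 1 / fund_unit D"
    using norm 1 by (simp add: OD_norm_def field_simps)
qed

section \<open>Meromorphy of the Gamma series\<close>

text \<open>This holds at the poles too, where both sides have the junk value 0.\<close>

lemma Gamma_shift: "Gamma (z :: complex) = Gamma (z + of_nat n) / pochhammer z n"
  using pochhammer_rGamma[of z n] by (simp add: Gamma_def divide_inverse)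

text \<open>All factors share the imaginary part of \<open>z\<close>: the first has modulus at least
  \<open>|Im z|\<close>, the others at least 1.\<close>

lemma abs_Im_le_norm_pochhammer:
  fixes z :: complex
  assumes "\<bar>Im z\<bar> \<ge> 1"
  shows "\<bar>Im z\<bar> \<le> norm (pochhammer z (Suc n))"
proof (induction n)
  case (Suc n)
  have "1 \<le> norm (z + of_nat (Suc n))"
    using abs_Im_le_cmod[of "z + of_nat (Suc n)"] assms by simp
  hence "\<bar>Im z\<bar> * 1 \<le> norm (pochhammer z (Suc n)) * norm (z + of_nat (Suc n))"
    using Suc by (intro mult_mono) auto
  thus ?case by (simp only: pochhammer_Suc[of z "Suc n"] norm_mult mult_1_right)
qed (use abs_Im_le_cmod[of z] in simp)

lemma norm_Gamma_le_shifted: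
  fixes z :: complex
  assumes "\<bar>Im z\<bar> \<ge> 1" "Re z + real (Suc n) > 0"
  shows "norm (Gamma z) \<le> Gamma (Re z + real (Suc n)) / \<bar>Im z\<bar>"
proof -
  have "norm (Gamma (z + of_nat (Suc n))) \<le> Gamma (Re z + real (Suc n))"
    using norm_Gamma_complex_le[of "z + of_nat (Suc n)"] assms(2) by simp
  thus ?thesis
    using abs_Im_le_norm_pochhammer[OF assms(1), of n] assms
    by (subst Gamma_shift[of _ "Suc n"]) (auto simp: norm_divide intro!: frac_le)
qed

text \<open>One power of \<open>1 / |Im z|\<close>, uniformly in a vertical strip; the two Gamma
  factors of a term together give the summable \<open>1 / m^2\<close>.\<close>

lemma Gamma_bound_away_from_real_axis:
  obtains K where "\<And>z :: complex. norm (Re z) \<le> R \<Longrightarrow> \<bar>Im z\<bar> \<ge> 1 \<Longrightarrow> norm (Gamma z) \<le> K / \<bar>Im z\<bar>"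
proof -
  \<comment> \<open>Since \<open>n > R\<close>, the shifted real parts fill a compact interval to
    the right of 0, where \<open>Gamma\<close> is bounded.\<close>
  obtain n :: nat where n: "R < real n" using reals_Archimedean2 by blast
  have "compact (Gamma ` {real (Suc n) - R..real (Suc n) + R})"
    using n by (intro compact_continuous_image continuous_on_Gamma) (auto elim!: nonpos_Ints_cases)
  then obtain K where K: "\<And>x. x \<in> {real (Suc n) - R..real (Suc n) + R} \<Longrightarrow> norm (Gamma x) \<le> K"
    using compact_imp_bounded bounded_iff by (metis imageI)
  have "norm (Gamma z) \<le> K / \<bar>Im z\<bar>" if z: "norm (Re z) \<le> R" "\<bar>Im z\<bar> \<ge> 1" for z :: complex
  proof -
    have "norm (Gamma z) \<le> Gamma (Re z + real (Suc n)) / \<bar>Im z\<bar>"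
      using z n by (intro norm_Gamma_le_shifted) auto
    also have "\<dots> \<le> K / \<bar>Im z\<bar>"
      using z K[of "Re z + real (Suc n)"]
      by (intro divide_right_mono) (auto simp: abs_le_iff)
    finally show ?thesis .
  qed
  with that show thesis by blast
qed

lemma norm_minus_one_powi [simp]: "norm ((-1 :: complex) powi m) = 1"
  by (simp add: norm_power_int)

lemma summable_on_inverse_squares_int: "(\<lambda>m :: int. K / of_int m ^ 2 :: real) summable_on A"
proof -
  have "(\<lambda>m :: int. 1 / of_int m ^ 2 :: real) summable_on UNIV"
    by (rule summable_on_int_symmetric[where B = "\<lambda>n. 1 / real n ^ 2"])
       (use inverse_power_summable[of 2, where ?'a = real] in \<open>auto simp: inverse_eq_divide\<close>)
  hence "(\<lambda>m :: int. K * (1 / of_int m ^ 2) :: real) summable_on UNIV" by (rule summable_on_cmult_right)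
  thus ?thesis using summable_on_subset_banach by fastforce
qed

lemma open_not_nonpos_Ints:
  fixes f :: "complex \<Rightarrow> complex"
  assumes "continuous_on UNIV f"
  shows "open {s. f s \<notin> \<int>\<^sub>\<le>\<^sub>0}"
proof -
  have "open (f -` (- \<int>\<^sub>\<le>\<^sub>0))"
    using assms by (intro open_vimage open_Compl closed_nonpos_Ints)
  thus ?thesis by (simp add: vimage_def)
qed

lemma open_pochhammer_nonzero:
  fixes c :: complex
  shows "open {s. pochhammer (s / 2 - c) k \<noteq> 0}"
proof -
  have "(\<lambda>s. pochhammer (s / 2 - c) k) holomorphic_on UNIV" by (intro holomorphic_intros) auto
  thus ?thesis by (intro open_Collect_neq holomorphic_on_imp_continuous_on) auto
qed

section \<open>Convergence, holomorphy and poles of the series of Gamma products\<close>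

context
  fixes D :: nat
  assumes eps: "fund_unit D > 1"
begin

text \<open>Half the imaginary part of a pole: the poles are the points
  \<open>-2k + 2 i freq m\<close>.\<close>

definition freq :: "int \<Rightarrow> real" where "freq m = pi * of_int m / (2 * ln (fund_unit D))"

lemma freq_0 [simp]: "freq 0 = 0" and freq_minus [simp]: "freq (- m) = - freq m"
  by (simp_all add: freq_def)

lemma freq_eq_iff [simp]: "freq m = freq n \<longleftrightarrow> m = n"
  using eps by (simp add: freq_def)

lemma gamma_term_eq:
  "Z_odd_gamma_term D s m = (-1) powi m * Gamma (s / 2 + \<i> * freq m) * Gamma (s / 2 - \<i> * freq m)"
  by (simp add: Z_odd_gamma_term_def freq_def mult.assoc)

lemma gamma_term_uminus: "Z_odd_gamma_term D s (- m) = Z_odd_gamma_term D s m"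
  unfolding gamma_term_eq by (simp add: power_int_minus_one_minus mult_ac)

lemma nonpos_Ints_poles:
  assumes "s \<notin> Z_odd_poles D"
  shows "s / 2 + \<i> * freq m \<notin> \<int>\<^sub>\<le>\<^sub>0" "s / 2 - \<i> * freq m \<notin> \<int>\<^sub>\<le>\<^sub>0"
proof -
  have 1: "s / 2 - \<i> * freq m \<notin> \<int>\<^sub>\<le>\<^sub>0" for m
  proof
    assume "s / 2 - \<i> * freq m \<in> \<int>\<^sub>\<le>\<^sub>0"
    then obtain k where "s / 2 - \<i> * freq m = - of_nat k" by (auto elim!: nonpos_Ints_cases')
    hence "s = - 2 * of_nat k + 2 * (\<i> * freq m)" by (simp add: field_simps)
    also have "2 * (\<i> * freq m) = \<i> * of_real pi * of_int m / of_real (ln (fund_unit D))"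
      by (simp add: freq_def)
    finally show False using assms unfolding Z_odd_poles_def by blast
  qed
  show "s / 2 - \<i> * freq m \<notin> \<int>\<^sub>\<le>\<^sub>0" by (rule 1)
  show "s / 2 + \<i> * freq m \<notin> \<int>\<^sub>\<le>\<^sub>0" using 1[of "- m"] by simp
qed

lemma gamma_term_tail_bound:
  obtains K M where "M > 0"
    "\<And>s m. s \<in> cball 0 R \<Longrightarrow> \<bar>m\<bar> \<ge> M \<Longrightarrow> norm (Z_odd_gamma_term D s m) \<le> K / of_int m ^ 2"
    "\<And>s m. s \<in> cball 0 R \<Longrightarrow> \<bar>m\<bar> \<ge> M \<Longrightarrow> s / 2 + \<i> * freq m \<notin> \<int>\<^sub>\<le>\<^sub>0 \<and> s / 2 - \<i> * freq m \<notin> \<int>\<^sub>\<le>\<^sub>0"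
proof -
  let ?L = "ln (fund_unit D)"
  have L: "?L > 0" using eps by simp
  \<comment> \<open>Here \<open>|freq m| = 2 c |m|\<close>. Once \<open>c |m| >= |R| + 1\<close>,
    moving by \<open>Im s / 2\<close> costs less than half of this, so the imaginary parts stay at
    least \<open>c |m|\<close>.\<close>
  define c where "c = pi / (4 * ?L)"
  have c: "c > 0" using L by (simp add: c_def)
  obtain K where K: "\<And>z :: complex. norm (Re z) \<le> R \<Longrightarrow> \<bar>Im z\<bar> \<ge> 1 \<Longrightarrow> norm (Gamma z) \<le> K / \<bar>Im z\<bar>"
    by (rule Gamma_bound_away_from_real_axis[of R]) blast
  define M where "M = max 1 \<lceil>(\<bar>R\<bar> + 1) / c\<rceil>"
  have Im: "\<bar>Im z\<bar> \<ge> 1 \<and> \<bar>Im z\<bar> \<ge> c * \<bar>of_int m\<bar> \<and> norm (Re z) \<le> R"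
    if s: "s \<in> cball 0 R" and m: "\<bar>m\<bar> \<ge> M" and z: "z = s / 2 + \<i> * freq m \<or> z = s / 2 - \<i> * freq m" for z s m
  proof -
    have s': "norm s \<le> R" using s by simp
    have "(\<bar>R\<bar> + 1) / c \<le> of_int \<lceil>(\<bar>R\<bar> + 1) / c\<rceil>" by (rule le_of_int_ceiling)
    also have "\<dots> \<le> \<bar>of_int m\<bar>" using m unfolding M_def by linarith
    finally have cm: "\<bar>R\<bar> + 1 \<le> c * \<bar>of_int m\<bar>" using c by (simp add: field_simps)
    have "\<bar>freq m\<bar> = 2 * (c * \<bar>of_int m\<bar>)"
      using L by (simp add: freq_def c_def abs_mult)
    moreover have "\<bar>freq m\<bar> - \<bar>Im s\<bar> / 2 \<le> \<bar>Im z\<bar>" using z by auto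
    moreover have "\<bar>Im s\<bar> \<le> R" using abs_Im_le_cmod[of s] s' by linarith
    moreover have "norm (Re z) = \<bar>Re s\<bar> / 2" using z by auto
    moreover have "\<bar>Re s\<bar> \<le> R" using abs_Re_le_cmod[of s] s' by linarith
    ultimately show ?thesis using cm by linarith
  qed
  show thesis
  proof (rule that[of M "(K / c)\<^sup>2"])
    show "M > 0" by (simp add: M_def)
    fix s :: complex and m :: int assume s: "s \<in> cball 0 R" and m: "\<bar>m\<bar> \<ge> M"
    have m0: "m \<noteq> 0" using m by (auto simp: M_def)
    have G: "norm (Gamma z) \<le> (K / c) / \<bar>of_int m\<bar>"
      if z: "z = s / 2 + \<i> * freq m \<or> z = s / 2 - \<i> * freq m" for z
    proof -
      have "norm (Gamma z) \<le> K / \<bar>Im z\<bar>" using K Im[OF s m z] by blast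
      moreover have "0 \<le> K / \<bar>Im z\<bar>" using calculation norm_ge_zero order.trans by blast
      hence "K \<ge> 0" using Im[OF s m z] by (auto simp: zero_le_divide_iff)
      hence "K / \<bar>Im z\<bar> \<le> K / (c * \<bar>of_int m\<bar>)" using Im[OF s m z] c m0 by (intro frac_le) auto
      ultimately show ?thesis by simp
    qed
    have "norm (Z_odd_gamma_term D s m) = norm (Gamma (s / 2 + \<i> * freq m)) * norm (Gamma (s / 2 - \<i> * freq m))"
      by (simp add: gamma_term_eq norm_mult)
    also have "\<dots> \<le> (K / c) / \<bar>of_int m\<bar> * ((K / c) / \<bar>of_int m\<bar>)"
      using G[of "s / 2 + \<i> * freq m"] G[of "s / 2 - \<i> * freq m"] norm_ge_zero order.trans
      by (intro mult_mono) blast+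
    also have "\<dots> = (K / c)\<^sup>2 / of_int m ^ 2"
      by (simp add: power2_eq_square)
    finally show "norm (Z_odd_gamma_term D s m) \<le> (K / c)\<^sup>2 / of_int m ^ 2" .
    have "z \<notin> \<int>\<^sub>\<le>\<^sub>0" if "\<bar>Im z\<bar> \<ge> 1" for z using that by (auto elim!: nonpos_Ints_cases)
    thus "s / 2 + \<i> * freq m \<notin> \<int>\<^sub>\<le>\<^sub>0 \<and> s / 2 - \<i> * freq m \<notin> \<int>\<^sub>\<le>\<^sub>0" using Im[OF s m] by blast
  qed
qed

text \<open>The Weierstrass M-test makes the tail holomorphic. The set \<open>A\<close> lets chosen
  terms, later those responsible for a given pole, be forced into the finite part.\<close>

lemma gamma_sum_decomposition:
  assumes A: "finite A"
  obtains M H where "finite M" "A \<subseteq> M" "H holomorphic_on ball 0 R"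
    "\<And>s. s \<in> ball 0 R \<Longrightarrow> Z_odd_gamma_term D s summable_on UNIV"
    "\<And>s. s \<in> ball 0 R \<Longrightarrow> (\<Sum>\<^sub>\<infinity>m. Z_odd_gamma_term D s m) = (\<Sum>m\<in>M. Z_odd_gamma_term D s m) + H s"
proof -
  obtain K M where KM: "M > 0"
    "\<And>s m. s \<in> cball 0 R \<Longrightarrow> \<bar>m\<bar> \<ge> M \<Longrightarrow> norm (Z_odd_gamma_term D s m) \<le> K / of_int m ^ 2"
    "\<And>s m. s \<in> cball 0 R \<Longrightarrow> \<bar>m\<bar> \<ge> M \<Longrightarrow> s / 2 + \<i> * freq m \<notin> \<int>\<^sub>\<le>\<^sub>0 \<and> s / 2 - \<i> * freq m \<notin> \<int>\<^sub>\<le>\<^sub>0"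
    by (rule gamma_term_tail_bound[of R]) (rule that)
  define X where "X = {m. \<bar>m\<bar> \<ge> M} - A"
  have "- X \<subseteq> {-M..M} \<union> A" by (auto simp: X_def)
  hence fin: "finite (- X)" by (rule finite_subset) (use A in simp)
  define H where "H s = (\<Sum>\<^sub>\<infinity>m\<in>X. Z_odd_gamma_term D s m)" for s
  have term_hol: "(\<lambda>s. Z_odd_gamma_term D s m) holomorphic_on cball 0 R" if "m \<in> X" for m
    unfolding gamma_term_eq using KM(3) that by (auto simp: X_def intro!: holomorphic_intros)
  have sums: "(\<lambda>m. norm (Z_odd_gamma_term D s m)) summable_on X" if "s \<in> cball 0 R" for s
    by (rule summable_on_comparison_test[OF summable_on_inverse_squares_int])
       (use KM(2)[OF that] in \<open>auto simp: X_def\<close>)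
  have ulim: "uniform_limit (cball 0 R) (\<lambda>X s. \<Sum>m\<in>X. Z_odd_gamma_term D s m) H (finite_subsets_at_top X)"
    unfolding H_def
    by (rule Weierstrass_m_test_general[OF _ summable_on_inverse_squares_int])
       (use KM(2) in \<open>auto simp: X_def\<close>)
  have H: "H holomorphic_on ball 0 R"
  proof (rule holomorphic_uniform_limit[OF _ ulim])
    have "eventually (\<lambda>Y. finite Y \<and> Y \<subseteq> X) (finite_subsets_at_top X)"
      by (simp add: eventually_finite_subsets_at_top_weakI)
    thus "\<forall>\<^sub>F Y in finite_subsets_at_top X. continuous_on (cball 0 R) (\<lambda>s. \<Sum>m\<in>Y. Z_odd_gamma_term D s m) \<and>
             (\<lambda>s. \<Sum>m\<in>Y. Z_odd_gamma_term D s m) holomorphic_on ball 0 R"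
    proof eventually_elim
      case (elim Y)
      hence "(\<lambda>s. \<Sum>m\<in>Y. Z_odd_gamma_term D s m) holomorphic_on cball 0 R"
        using term_hol by (intro holomorphic_on_sum) auto
      thus ?case using holomorphic_on_imp_continuous_on holomorphic_on_subset ball_subset_cball by blast
    qed
  qed auto
  show thesis
  proof (rule that[OF fin _ H])
    show "A \<subseteq> - X" by (auto simp: X_def)
    fix s :: complex assume s: "s \<in> ball 0 R"
    have X: "Z_odd_gamma_term D s summable_on X"
      by (rule abs_summable_summable[OF sums]) (use s in simp)
    have "Z_odd_gamma_term D s summable_on (- X \<union> X)"
      by (rule summable_on_union[OF summable_on_finite[OF fin] X])
    thus "Z_odd_gamma_term D s summable_on UNIV" by simp
    have "infsum (Z_odd_gamma_term D s) (- X \<union> X) = infsum (Z_odd_gamma_term D s) (- X) + H s"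
      unfolding H_def by (rule infsum_Un_disjoint[OF summable_on_finite[OF fin] X]) simp
    thus "(\<Sum>\<^sub>\<infinity>m. Z_odd_gamma_term D s m) = (\<Sum>m\<in>- X. Z_odd_gamma_term D s m) + H s"
      using fin by simp
  qed
qed

text \<open>Poles are included: only finitely many terms are singular there, and these have the junk
  value 0.\<close>

lemma gamma_term_summable: "Z_odd_gamma_term D s summable_on UNIV"
  by (rule gamma_sum_decomposition[of "{}" "norm s + 1"]) auto

lemma Z_odd_cont_holomorphic: "Z_odd_cont D holomorphic_on (- Z_odd_poles D)"
proof -
  have "Z_odd_cont D field_differentiable at s within (- Z_odd_poles D)" if s: "s \<notin> Z_odd_poles D" for s
  proof -
    let ?B = "ball 0 (norm s + 1) :: complex set" and ?P = "- Z_odd_poles D"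
    obtain M H where MH: "finite M" "H holomorphic_on ?B"
      "\<And>s. s \<in> ?B \<Longrightarrow> (\<Sum>\<^sub>\<infinity>m. Z_odd_gamma_term D s m) = (\<Sum>m\<in>M. Z_odd_gamma_term D s m) + H s"
      by (rule gamma_sum_decomposition[of "{}" "norm s + 1"]) (simp, rule that)
    have H: "H holomorphic_on (?P \<inter> ?B)" using MH(2) by (rule holomorphic_on_subset) auto
    have "(\<lambda>s. of_real (real (qD D)) powr (s / 2) * rGamma s / (8 * of_real (ln (fund_unit D))) *
              ((\<Sum>m\<in>M. Z_odd_gamma_term D s m) + H s)) holomorphic_on (?P \<inter> ?B)"
      unfolding gamma_term_eq using eps nonpos_Ints_poles
      by (intro holomorphic_intros H) auto
    hence "Z_odd_cont D holomorphic_on (?P \<inter> ?B)"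
      by (rule holomorphic_transform) (auto simp: Z_odd_cont_def MH(3))
    hence "Z_odd_cont D field_differentiable at s within (?P \<inter> ?B)"
      using s by (auto simp: holomorphic_on_def)
    \<comment> \<open>The ball is an open neighbourhood of \<open>s\<close>, so restricting to it
      does not change differentiability at \<open>s\<close>.\<close>
    moreover have "at s within (?P \<inter> ?B) = at s within ?P"
      by (rule at_within_nhd[of _ ?B]) auto
    ultimately show ?thesis by simp
  qed
  thus ?thesis by (auto simp: holomorphic_on_def)
qed

text \<open>Shifting \<open>Gamma\<close> by \<open>k + 1\<close> exposes the vanishing factor
  \<open>(s - p) / 2\<close>; everything else is holomorphic and nonzero at \<open>p\<close>. The
  index set is a singleton when \<open>m = 0\<close>.\<close>

lemma polar_part:
  fixes m :: int and k :: nat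
  assumes p_def: "p = - 2 * of_nat k + 2 * (\<i> * freq m)"
  obtains S h where "open S" "p \<in> S" "h holomorphic_on S" "h p \<noteq> 0"
    "\<And>s. s \<in> S \<Longrightarrow> s \<noteq> p \<Longrightarrow> rGamma s * (\<Sum>n\<in>{m, - m}. Z_odd_gamma_term D s n) = h s / (s - p)"
proof (cases "m = 0")
  case m: True
  have p: "p = - of_nat (2 * k)" by (simp add: p_def m)
  define S where "S = {s. s / 2 + of_nat (Suc k) \<notin> \<int>\<^sub>\<le>\<^sub>0} \<inter> {s :: complex. pochhammer (s / 2 - 0) k \<noteq> 0}"
  \<comment> \<open>The 4 comes from squaring \<open>2 / (s - p)\<close>. Shifting
    \<open>rGamma s\<close> by \<open>2k + 1\<close> supplies the factor \<open>s - p\<close> that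
    lowers the double pole to a simple one.\<close>
  define h where "h s = pochhammer s (2 * k) * rGamma (s + of_nat (Suc (2 * k))) *
      4 * (Gamma (s / 2 + of_nat (Suc k)) / pochhammer (s / 2) k)\<^sup>2" for s :: complex
  show thesis
  proof (rule that[of S h])
    show "open S" unfolding S_def
      by (intro open_Int open_pochhammer_nonzero open_not_nonpos_Ints continuous_intros) auto
    have 1: "p / 2 + of_nat (Suc k) = 1" "p / 2 = - of_nat k" "p + of_nat (Suc (2 * k)) = 1" by (simp_all add: p)
    show "p \<in> S" unfolding S_def using 1 by (simp add: pochhammer_same del: of_nat_Suc)
    show "h holomorphic_on S" unfolding h_def S_def
      by (intro holomorphic_intros) auto
    have "pochhammer p (2 * k) \<noteq> 0" unfolding p by (simp only: pochhammer_same) simp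
    thus "h p \<noteq> 0" unfolding h_def 1 by (simp add: pochhammer_same)
    fix s assume s: "s \<in> S" "s \<noteq> p"
    have sp: "s + of_nat (2 * k) = s - p" "s / 2 + of_nat k = (s - p) / 2" by (simp_all add: p field_simps)
    have G: "Gamma (s / 2) = Gamma (s / 2 + of_nat (Suc k)) / (pochhammer (s / 2) k * ((s - p) / 2))"
      by (subst Gamma_shift[of _ "Suc k"]) (simp only: pochhammer_Suc sp)
    have r: "rGamma s = pochhammer s (2 * k) * (s - p) * rGamma (s + of_nat (Suc (2 * k)))"
      by (subst pochhammer_rGamma[of _ "Suc (2 * k)"]) (simp only: pochhammer_Suc sp)
    have "(\<Sum>n\<in>{m, - m}. Z_odd_gamma_term D s n) = Gamma (s / 2) * Gamma (s / 2)"
      by (simp add: m gamma_term_eq)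
    moreover have "X * d * R * (Q / (P * (d / 2)) * (Q / (P * (d / 2)))) = X * R * 4 * (Q / P)\<^sup>2 / d"
      if "d \<noteq> 0" "P \<noteq> 0" for X d R P Q :: complex
      using that by (simp add: field_simps power2_eq_square)
    ultimately show "rGamma s * (\<Sum>n\<in>{m, - m}. Z_odd_gamma_term D s n) = h s / (s - p)"
      using s unfolding h_def S_def by (simp only: r G) simp
  qed
next
  case m: False
  have y: "freq m \<noteq> 0" using m freq_eq_iff[of m 0] by simp
  define S where "S = {s. s / 2 - \<i> * freq m + of_nat (Suc k) \<notin> \<int>\<^sub>\<le>\<^sub>0} \<inter> {s. s / 2 + \<i> * freq m \<notin> \<int>\<^sub>\<le>\<^sub>0} \<inter>
      {s. pochhammer (s / 2 - \<i> * freq m) k \<noteq> 0}"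
  \<comment> \<open>The 4 is 2 for the equal terms at \<open>m\<close> and \<open>-m\<close>, times
    2 from \<open>(s - p) / 2\<close>.\<close>
  define h where "h s = rGamma s * (4 * (-1) powi m) * Gamma (s / 2 + \<i> * freq m) *
      (Gamma (s / 2 - \<i> * freq m + of_nat (Suc k)) / pochhammer (s / 2 - \<i> * freq m) k)" for s :: complex
  have nonreal: "z \<notin> \<int>\<^sub>\<le>\<^sub>0" if "Im z \<noteq> 0" for z :: complex using that by (auto elim!: nonpos_Ints_cases)
  show thesis
  proof (rule that[of S h])
    show "open S" unfolding S_def
      by (intro open_Int open_pochhammer_nonzero open_not_nonpos_Ints continuous_intros) auto
    have 1: "p / 2 - \<i> * freq m + of_nat (Suc k) = 1" "p / 2 - \<i> * freq m = - of_nat k" by (simp_all add: p_def field_simps)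
    \<comment> \<open>Both numbers have imaginary part \<open>2 * freq m\<close>, so
      \<open>rGamma\<close> does not vanish at \<open>p\<close> and the other Gamma factor is
      regular.\<close>
    have 2: "p \<notin> \<int>\<^sub>\<le>\<^sub>0" "p / 2 + \<i> * freq m \<notin> \<int>\<^sub>\<le>\<^sub>0" using y by (intro nonreal; simp add: p_def)+
    show "p \<in> S" unfolding S_def using 1 2 by (simp add: pochhammer_same del: of_nat_Suc)
    show "h holomorphic_on S" unfolding h_def S_def
      by (intro holomorphic_intros) auto
    show "h p \<noteq> 0" unfolding h_def 1 using 2 by (simp add: pochhammer_same Gamma_eq_zero_iff rGamma_eq_zero_iff)
    fix s assume s: "s \<in> S" "s \<noteq> p"
    have sp: "s / 2 - \<i> * freq m + of_nat k = (s - p) / 2" by (simp add: p_def field_simps)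
    have G: "Gamma (s / 2 - \<i> * freq m) = Gamma (s / 2 - \<i> * freq m + of_nat (Suc k)) / (pochhammer (s / 2 - \<i> * freq m) k * ((s - p) / 2))"
      by (subst Gamma_shift[of _ "Suc k"]) (simp only: pochhammer_Suc sp)
    have "m \<noteq> - m" using m by presburger
    hence "(\<Sum>n\<in>{m, - m}. Z_odd_gamma_term D s n) = 2 * Z_odd_gamma_term D s m"
      by (simp add: gamma_term_uminus)
    moreover have "R * (2 * (X * Y * (Q / (P * (d / 2))))) = R * (4 * X) * Y * (Q / P) / d"
      if "d \<noteq> 0" "P \<noteq> 0" for X d R P Q Y :: complex
      using that by (simp add: field_simps)
    ultimately show "rGamma s * (\<Sum>n\<in>{m, - m}. Z_odd_gamma_term D s n) = h s / (s - p)"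
      using s unfolding h_def S_def by (simp only: gamma_term_eq G) simp
  qed
qed

lemma Z_odd_cont_simple_pole:
  assumes qD: "qD D \<noteq> 0" and "p \<in> Z_odd_poles D"
  shows "is_pole (Z_odd_cont D) p" "zorder (Z_odd_cont D) p = - 1"
proof -
  obtain k m where "p = - 2 * of_nat k + \<i> * of_real pi * of_int m / of_real (ln (fund_unit D))"
    using assms(2) unfolding Z_odd_poles_def by blast
  hence p: "p = - 2 * of_nat k + 2 * (\<i> * freq m)" by (simp add: freq_def)
  obtain S h where S: "open S" "p \<in> S" "h holomorphic_on S" "h p \<noteq> 0"
    and h: "\<And>s. s \<in> S \<Longrightarrow> s \<noteq> p \<Longrightarrow> rGamma s * (\<Sum>n\<in>{m, - m}. Z_odd_gamma_term D s n) = h s / (s - p)"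
    by (rule polar_part[OF p]) (rule that)
  let ?B = "ball 0 (norm p + 1) :: complex set"
  obtain M H where M: "finite M" "{m, - m} \<subseteq> M" and H: "H holomorphic_on ?B"
    and sum_eq: "\<And>s. s \<in> ?B \<Longrightarrow> (\<Sum>\<^sub>\<infinity>m. Z_odd_gamma_term D s m) = (\<Sum>m\<in>M. Z_odd_gamma_term D s m) + H s"
    by (rule gamma_sum_decomposition[of "{m, - m}" "norm p + 1"]) (simp, rule that)
  define N where "N = M - {m, - m}"
  define U where "U = S \<inter> ?B \<inter> (\<Inter>n\<in>N. {s. s / 2 + \<i> * freq n \<notin> \<int>\<^sub>\<le>\<^sub>0} \<inter> {s. s / 2 - \<i> * freq n \<notin> \<int>\<^sub>\<le>\<^sub>0})"
  define A where "A s = of_real (real (qD D)) powr (s / 2) / (8 * of_real (ln (fund_unit D)))" for s :: complex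
  \<comment> \<open>At \<open>s = p\<close> the second summand vanishes, leaving
    \<open>A p * h p\<close>, which is nonzero.\<close>
  define g where "g s = A s * (h s + (s - p) * rGamma s * ((\<Sum>n\<in>N. Z_odd_gamma_term D s n) + H s))" for s
  have U: "open U" unfolding U_def N_def
    by (intro open_Int S open_ball open_INT finite_Diff M ballI open_not_nonpos_Ints continuous_intros) auto
  have pU: "p \<in> U"
  proof -
    have nonreal: "z \<notin> \<int>\<^sub>\<le>\<^sub>0" if "Im z \<noteq> 0" for z :: complex using that by (auto elim!: nonpos_Ints_cases)
    have "p / 2 + \<i> * freq n \<notin> \<int>\<^sub>\<le>\<^sub>0" "p / 2 - \<i> * freq n \<notin> \<int>\<^sub>\<le>\<^sub>0" if "n \<in> N" for n
    proof -
      \<comment> \<open>The imaginary part of \<open>p\<close> determines \<open>m\<close>, so no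
        term with index other than \<open>m\<close> and \<open>-m\<close> is singular at
        \<open>p\<close>.\<close>
      have "freq m \<noteq> freq (- n)" "freq m \<noteq> freq n" using that by (auto simp: N_def simp del: freq_minus)
      thus "p / 2 + \<i> * freq n \<notin> \<int>\<^sub>\<le>\<^sub>0" "p / 2 - \<i> * freq n \<notin> \<int>\<^sub>\<le>\<^sub>0" by (intro nonreal; simp add: p)+
    qed
    thus ?thesis using S by (auto simp: U_def)
  qed
  have g: "g holomorphic_on U"
    unfolding g_def A_def gamma_term_eq using qD eps
    by (intro holomorphic_intros holomorphic_on_subset[OF S(3)] holomorphic_on_subset[OF H]) (auto simp: U_def)
  have gp: "g p \<noteq> 0" using S(4) qD eps by (simp add: g_def A_def)
  have Z: "Z_odd_cont D s = g s / (s - p)" if s: "s \<in> U" "s \<noteq> p" for s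
  proof -
    have "(\<Sum>m\<in>M. Z_odd_gamma_term D s m) = (\<Sum>n\<in>{m, - m}. Z_odd_gamma_term D s n) + (\<Sum>n\<in>N. Z_odd_gamma_term D s n)"
      unfolding N_def using M by (subst sum.subset_diff[of "{m, - m}" M]) (auto simp: add.commute)
    hence "Z_odd_cont D s = A s * (rGamma s * (\<Sum>n\<in>{m, - m}. Z_odd_gamma_term D s n) +
        rGamma s * ((\<Sum>n\<in>N. Z_odd_gamma_term D s n) + H s))"
      using s sum_eq[of s] by (simp add: Z_odd_cont_def A_def U_def algebra_simps add_divide_distrib)
    also have "\<dots> = g s / (s - p)"
      using s h[of s] by (simp add: g_def U_def add_divide_distrib distrib_left)
    finally show ?thesis .
  qed
  show "zorder (Z_odd_cont D) p = - 1"
    by (rule zorder_eqI[OF U pU g gp]) (simp add: Z divide_inverse power_int_minus)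
  have "is_pole (\<lambda>w. g w / (w - p) ^ 1) p"
    by (rule is_pole_basic[OF g U pU gp]) simp
  moreover have "\<forall>\<^sub>F w in at p. Z_odd_cont D w = g w / (w - p) ^ 1"
    using U pU Z by (auto simp: eventually_at_topological)
  ultimately show "is_pole (Z_odd_cont D) p"
    by (subst is_pole_cong[OF _ refl])
qed

end

section \<open>The Dirichlet series\<close>

text \<open>This is \<open>ln (2 cosh x)\<close>; through it complex powers of
  \<open>2 cosh x\<close> become exponentials without a choice of branch.\<close>

definition log_cosh :: "real \<Rightarrow> real" where "log_cosh x = ln (exp x + exp (- x))"

lemma exp_log_cosh: "exp (log_cosh x) = exp x + exp (- x)"
  by (simp add: log_cosh_def add_pos_pos)

lemma log_cosh_uminus [simp]: "log_cosh (- x) = log_cosh x"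
  by (simp add: log_cosh_def add.commute)

lemma abs_le_log_cosh: "\<bar>x\<bar> \<le> log_cosh x"
proof -
  have "exp \<bar>x\<bar> \<le> exp (log_cosh x)"
    unfolding exp_log_cosh by (cases "x \<ge> 0") auto
  thus ?thesis by simp
qed

lemma log_cosh_has_derivative: "(log_cosh has_real_derivative tanh x) (at x)"
  unfolding log_cosh_def
  by (auto intro!: derivative_eq_intros add_pos_pos simp: tanh_altdef)

text \<open>Turns the Beta integrand at \<open>v = 2 x\<close> into a power of
  \<open>2 cosh x\<close> times an exponential.\<close>

lemma log_one_plus_exp: "ln (1 + exp (2 * x)) = x + log_cosh x"
proof -
  have "1 + exp (2 * x) = exp x * exp (log_cosh x)"
    by (simp add: exp_log_cosh distrib_left mult_exp_exp)
  also have "\<dots> = exp (x + log_cosh x)" by (simp add: exp_add)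
  finally show ?thesis by simp
qed

context
  fixes D :: nat
  assumes eps: "fund_unit D > 1" and conj: "OD_conj D (fund_unit D) = - 1 / fund_unit D" and D: "D > 0"
begin

text \<open>At odd exponents the conjugate \<open>-1 / eps\<close> contributes a second minus sign,
  so the difference becomes a sum, that is, a hyperbolic cosine.\<close>

lemma F_D_odd: "F_D D (2 * n + 1) = exp (log_cosh (ln (fund_unit D) * (2 * real n + 1))) / sqrt (real (qD D))"
proof -
  let ?e = "fund_unit D"
  have "exp (ln ?e * (2 * real n + 1)) = exp (real (2 * n + 1) * ln ?e)"
    by (simp add: algebra_simps)
  also have "\<dots> = ?e ^ (2 * n + 1)"
    unfolding exp_of_nat_mult using eps by simp
  finally have "?e ^ (2 * n + 1) = exp (ln ?e * (2 * real n + 1))" ..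
  moreover have "(- 1 / ?e) ^ (2 * n + 1) = - inverse (?e ^ (2 * n + 1))"
    by (simp add: power_divide divide_inverse power_inverse)
  ultimately show ?thesis
    unfolding F_D_def conj exp_log_cosh by (simp only: exp_minus) simp
qed

section \<open>Poisson summation for the Dirichlet series in the right half-plane\<close>

context
  fixes s :: complex
  assumes s: "Re s > 0"
begin

text \<open>At \<open>u = n\<close> this is the Dirichlet term \<open>F_D(2n+1)^(-s)\<close> without
  its factor \<open>q^(s/2)\<close>.\<close>

definition kern :: "real \<Rightarrow> complex" where
  "kern u = exp (- s * of_real (log_cosh (ln (fund_unit D) * (2 * u + 1))))"

lemma norm_kern_le:
  "norm (kern u) \<le> exp (Re s * ln (fund_unit D)) * exp (- (2 * Re s * ln (fund_unit D)) * \<bar>u\<bar>)"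
proof -
  let ?L = "ln (fund_unit D)"
  have L: "?L > 0" using eps by simp
  have "2 * \<bar>u\<bar> - 1 \<le> \<bar>2 * u + 1\<bar>" by linarith
  hence "?L * (2 * \<bar>u\<bar> - 1) \<le> ?L * \<bar>2 * u + 1\<bar>" using L by (intro mult_left_mono) auto
  also have "\<dots> = \<bar>?L * (2 * u + 1)\<bar>" using L by (simp add: abs_mult)
  also have "\<dots> \<le> log_cosh (?L * (2 * u + 1))" by (rule abs_le_log_cosh)
  finally have "Re s * (?L * (2 * \<bar>u\<bar> - 1)) \<le> Re s * log_cosh (?L * (2 * u + 1))"
    using s by (intro mult_left_mono) auto
  thus ?thesis unfolding kern_def mult_exp_exp by (simp add: algebra_simps)
qed

lemma kern_has_derivative:
  "(kern has_vector_derivative (- s * of_real (2 * ln (fund_unit D) * tanh (ln (fund_unit D) * (2 * u + 1))) * kern u)) (at u)"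
proof -
  let ?L = "ln (fund_unit D)"
  have 1: "((\<lambda>u. log_cosh (?L * (2 * u + 1))) has_real_derivative (2 * ?L * tanh (?L * (2 * u + 1)))) (at u)"
    by (rule DERIV_cong[OF DERIV_chain'[OF _ log_cosh_has_derivative]])
       (auto intro!: derivative_eq_intros)
  have 2: "((\<lambda>u. of_real (log_cosh (?L * (2 * u + 1))) :: complex) has_vector_derivative of_real (2 * ?L * tanh (?L * (2 * u + 1)))) (at u)"
    using 1 by (intro has_vector_derivative_of_real) (simp add: has_real_derivative_iff_has_vector_derivative)
  have 3: "((\<lambda>z. exp (- s * z)) has_field_derivative (- s * exp (- s * z))) (at z)" for z
    by (auto intro!: derivative_eq_intros)
  show ?thesis
    using field_vector_diff_chain_at[OF 2 3] unfolding kern_def o_def by (simp add: mult_ac)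
qed

text \<open>The Beta integral under \<open>v = 2 L (2u + 1)\<close> with \<open>L = ln eps\<close>.
  The Jacobian is \<open>4 L\<close>, and the offset \<open>2 L\<close> produces the sign
  \<open>(-1)^m\<close>.\<close>

lemma kern_Fourier:
  "integral\<^sup>L lborel (\<lambda>u. kern u * cis (2 * pi * of_int m * u))
     = rGamma s * Z_odd_gamma_term D s m / (4 * ln (fund_unit D))"
proof -
  let ?L = "ln (fund_unit D)"
  define y where "y = pi * of_int m / (2 * ?L)"
  define a where "a = s / 2 + \<i> * of_real y"
  define b where "b = s / 2 - \<i> * of_real y"
  have L: "?L > 0" using eps by simp
  have ab: "a + b = s" "Re a > 0" "Re b > 0" using s by (auto simp: a_def b_def)
  have T: "Z_odd_gamma_term D s m = (-1) powi m * (Gamma a * Gamma b)"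
    unfolding Z_odd_gamma_term_def by (simp add: a_def b_def y_def mult.assoc)
  let ?h = "\<lambda>v::real. exp (a * of_real v - s * of_real (ln (1 + exp v)))"
  have h: "?h (2 * ?L + 4 * ?L * u) = (-1) powi m * (kern u * cis (2 * pi * of_int m * u))" for u
  proof -
    define x where "x = ?L * (2 * u + 1)"
    have v: "2 * ?L + 4 * ?L * u = 2 * x" by (simp add: x_def algebra_simps)
    have yx: "2 * y * x = of_int m * pi + 2 * pi * of_int m * u" using L by (simp add: y_def x_def field_simps)
    have "?h (2 * x) = exp (- s * of_real (log_cosh x) + \<i> * of_real (2 * y * x))"
      unfolding log_one_plus_exp by (simp add: a_def algebra_simps)
    also have "\<dots> = kern u * cis (2 * y * x)"
      unfolding exp_add cis_conv_exp kern_def x_def ..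
    also have "cis (2 * y * x) = (-1) powi m * cis (2 * pi * of_int m * u)"
      unfolding yx cis_mult[symmetric] cis_power_int[symmetric] by simp
    finally show ?thesis unfolding v by (simp only: mult_ac)
  qed
  have "Gamma a * Gamma b = Gamma s * integral\<^sup>L lborel ?h"
    using Gamma_mult_integral[OF ab(2,3)] by (simp only: ab(1))
  also have "integral\<^sup>L lborel ?h = \<bar>4 * ?L\<bar> *\<^sub>R integral\<^sup>L lborel (\<lambda>u. ?h (2 * ?L + 4 * ?L * u))"
    using L by (intro lborel_integral_real_affine) auto
  also have "\<dots> = of_real (4 * ?L) * ((-1) powi m * integral\<^sup>L lborel (\<lambda>u. kern u * cis (2 * pi * of_int m * u)))"
    unfolding h using L by (simp add: scaleR_conv_of_real)
  finally have "Z_odd_gamma_term D s m = ((-1) powi m * (-1) powi m) * Gamma s * of_real (4 * ?L) *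
      integral\<^sup>L lborel (\<lambda>u. kern u * cis (2 * pi * of_int m * u))"
    unfolding T by (simp only: mult_ac)
  also have "(-1) powi m * (-1) powi m = (1 :: complex)" by (simp add: power_int_mult_distrib[symmetric])
  finally show ?thesis
    using s L by (simp add: Gamma_eq_zero_iff rGamma_inverse_Gamma field_simps) (auto elim!: nonpos_Ints_cases)
qed

text \<open>The reflection \<open>n\<close> to \<open>-1 - n\<close> changes the sign of
  \<open>2n + 1\<close> and preserves the even kernel. The sum over all integers is thus twice the
  wanted one, and the 4 of the Fourier transform becomes 8.\<close>

lemma kern_sum: 
  "((\<lambda>n. kern (real n)) has_sum (rGamma s / (8 * ln (fund_unit D)) * (\<Sum>\<^sub>\<infinity>m. Z_odd_gamma_term D s m))) UNIV"
proof -
  let ?L = "ln (fund_unit D)"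
  let ?g' = "\<lambda>u. - s * of_real (2 * ?L * tanh (?L * (2 * u + 1))) * kern u"
  \<comment> \<open>One constant must serve both the kernel and its derivative; the latter has the
    extra factor \<open>2 L |s| |tanh|\<close>, with \<open>|tanh| <= 1\<close>.\<close>
  define C where "C = max 1 (norm s * (2 * ?L)) * exp (Re s * ?L)"
  define c where "c = 2 * Re s * ?L"
  have L: "?L > 0" using eps by simp
  have c: "c > 0" using L s by (simp add: c_def)
  have kern_le: "K * norm (kern u) \<le> C * exp (- c * \<bar>u\<bar>)" if "0 \<le> K" "K \<le> max 1 (norm s * (2 * ?L))" for u K
  proof -
    have "K * norm (kern u) \<le> max 1 (norm s * (2 * ?L)) * (exp (Re s * ?L) * exp (- c * \<bar>u\<bar>))"
      unfolding c_def by (intro mult_mono that norm_kern_le) auto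
    thus ?thesis by (simp add: C_def mult.assoc)
  qed
  have g_le: "norm (kern u) \<le> C * exp (- c * \<bar>u\<bar>)" for u
    using kern_le[of 1 u] by simp
  have g'_le: "norm (?g' u) \<le> C * exp (- c * \<bar>u\<bar>)" for u
  proof -
    have "norm (?g' u) = norm s * (2 * ?L * \<bar>tanh (?L * (2 * u + 1))\<bar>) * norm (kern u)"
      using L by (simp add: norm_mult abs_mult)
    also have "\<dots> \<le> C * exp (- c * \<bar>u\<bar>)"
    proof (rule kern_le)
      have "\<bar>tanh (?L * (2 * u + 1))\<bar> \<le> 1"
        using tanh_real_lt_1[of "?L * (2 * u + 1)"] tanh_real_gt_neg1[of "?L * (2 * u + 1)"] by (simp add: abs_le_iff)
      hence "norm s * (2 * ?L * \<bar>tanh (?L * (2 * u + 1))\<bar>) \<le> norm s * (2 * ?L * 1)"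
        using L by (intro mult_left_mono) auto
      thus "norm s * (2 * ?L * \<bar>tanh (?L * (2 * u + 1))\<bar>) \<le> max 1 (norm s * (2 * ?L))" by simp
    qed (use L in auto)
    finally show ?thesis .
  qed
  let ?T = "\<Sum>\<^sub>\<infinity>m. Z_odd_gamma_term D s m"
  have "(\<lambda>m. rGamma s / (4 * ?L) * Z_odd_gamma_term D s m) summable_on UNIV"
    by (rule summable_on_cmult_right[OF gamma_term_summable[OF eps]])
  hence hat: "(\<lambda>m. integral\<^sup>L lborel (\<lambda>u. kern u * cis (2 * pi * of_int m * u))) summable_on UNIV"
    unfolding kern_Fourier by (simp add: field_simps)
  have "(\<Sum>\<^sub>\<infinity>n. kern (of_int n)) = (\<Sum>\<^sub>\<infinity>m. integral\<^sup>L lborel (\<lambda>u. kern u * cis (2 * pi * of_int m * u)))"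
    by (rule Poisson_summation[OF kern_has_derivative c g_le g'_le hat])
  also have "\<dots> = (\<Sum>\<^sub>\<infinity>m. rGamma s / (4 * ?L) * Z_odd_gamma_term D s m)"
    unfolding kern_Fourier by simp
  also have "\<dots> = rGamma s / (4 * ?L) * ?T"
    by (rule infsum_cmult_right[OF gamma_term_summable[OF eps]])
  finally have total: "(\<Sum>\<^sub>\<infinity>n. kern (of_int n)) = rGamma s / (4 * ?L) * ?T" .
  have summ: "(\<lambda>n. kern (of_int n)) summable_on (A :: int set)" for A
    using summable_g_of_int[OF kern_has_derivative c g_le g'_le] summable_on_subset_banach by blast
  have refl: "kern (real_of_int (- 1 - int n)) = kern (real n)" for n
  proof -
    have "?L * (2 * real_of_int (- 1 - int n) + 1) = - (?L * (2 * real n + 1))" by (simp add: algebra_simps)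
    thus ?thesis by (simp only: kern_def log_cosh_uminus)
  qed
  define S where "S = (\<Sum>\<^sub>\<infinity>n. kern (real n))"
  have 1: "(\<Sum>\<^sub>\<infinity>n\<in>range int. kern (of_int n)) = S" 
    unfolding S_def by (subst infsum_reindex) (auto simp: o_def)
  have 2: "(\<Sum>\<^sub>\<infinity>n\<in>range (\<lambda>n. - 1 - int n). kern (of_int n)) = S" 
    unfolding S_def by (subst infsum_reindex) (auto simp: o_def refl inj_on_def simp del: of_int_diff)
  have "m \<in> range int \<union> range (\<lambda>n. - 1 - int n)" for m
  proof (cases "m \<ge> 0")
    case True
    thus ?thesis by (metis UnI1 rangeI zero_le_imp_eq_int)
  next
    case False
    hence "m = - 1 - int (nat (- 1 - m))" by simp
    thus ?thesis by blast
  qed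
  hence "range int \<union> range (\<lambda>n. - 1 - int n) = UNIV" by blast
  hence "(\<Sum>\<^sub>\<infinity>n. kern (of_int n)) = (\<Sum>\<^sub>\<infinity>n\<in>range int \<union> range (\<lambda>n. - 1 - int n). kern (of_int n))" by simp
  also have "\<dots> = S + S"
    by (subst infsum_Un_disjoint[OF summ summ]) (auto simp: 1 2)
  finally have "S = rGamma s / (8 * ?L) * ?T" using total L by (simp add: field_simps)
  moreover have "(\<lambda>n. kern (real n)) summable_on UNIV"
    using summ[of "range int"] by (subst (asm) summable_on_reindex) (auto simp: o_def)
  ultimately show ?thesis unfolding S_def by (metis has_sum_infsum)
qed

lemma Z_odd_sums: "(\<lambda>n. complex_of_real (F_D D (2 * n + 1)) powr (- s)) sums Z_odd_cont D s"
proof -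
  let ?q = "real (qD D)"
  have q: "?q > 0" using D by (simp add: qD_def)
  have "complex_of_real (F_D D (2 * n + 1)) powr (- s) = of_real ?q powr (s / 2) * kern (real n)" for n
  proof -
    define w where "w = log_cosh (ln (fund_unit D) * (2 * real n + 1))"
    have F: "F_D D (2 * n + 1) = exp w / sqrt ?q" by (simp only: F_D_odd w_def)
    \<comment> \<open>The base is positive, so the principal logarithm is the real one and the power
      of \<open>q\<close> splits off.\<close>
    have "complex_of_real (exp w / sqrt ?q) powr (- s) = exp (- s * of_real (ln (exp w / sqrt ?q)))"
    proof -
      have pos: "exp w / sqrt ?q > 0" using q by simp
      thus ?thesis by (simp only: powr_def Ln_of_real[OF pos] of_real_eq_0_iff) (use q in simp)
    qed
    also have "ln (exp w / sqrt ?q) = w - ln ?q / 2"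
      using q by (simp add: ln_div ln_sqrt)
    also have "exp (- s * of_real (w - ln ?q / 2)) = exp (s / 2 * of_real (ln ?q)) * exp (- s * of_real w)"
      by (simp add: mult_exp_exp algebra_simps)
    also have "exp (s / 2 * of_real (ln ?q)) = of_real ?q powr (s / 2)"
      using q by (simp only: powr_def Ln_of_real) simp
    also have "exp (- s * of_real w) = kern (real n)"
      by (simp add: kern_def w_def)
    finally show ?thesis unfolding F .
  qed
  moreover have "(\<lambda>n. of_real ?q powr (s / 2) * kern (real n)) sums
      (of_real ?q powr (s / 2) * (rGamma s / (8 * ln (fund_unit D)) * (\<Sum>\<^sub>\<infinity>m. Z_odd_gamma_term D s m)))"
    by (intro sums_mult has_sum_imp_sums kern_sum)
  ultimately show ?thesis by (simp add: Z_odd_cont_def mult.assoc)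
qed

end

end

theorem mainTheorem6:
  fixes D :: nat
  assumes "squarefree D" and "D > 1"
    and "OD_norm D (fund_unit D) = -1"
  shows "(\<forall>s. s \<notin> Z_odd_poles D \<longrightarrow> Z_odd_gamma_term D s summable_on (UNIV :: int set))
     \<and> (\<forall>s. 0 < Re s \<longrightarrow>
            summable (\<lambda>n. complex_of_real (F_D D (2 * n + 1)) powr (- s))
          \<and> Z_odd D s = Z_odd_cont D s)
     \<and> Z_odd_cont D holomorphic_on (- Z_odd_poles D)
     \<and> (\<forall>p \<in> Z_odd_poles D. is_pole (Z_odd_cont D) p \<and> zorder (Z_odd_cont D) p = -1)"
proof -
  note eps = fund_unit_norm_minus_one(1)[OF assms]
  have D: "D > 0" using assms(2) by simp
  have qD: "qD D \<noteq> 0" using D by (simp add: qD_def)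
  have sums: "summable (\<lambda>n. complex_of_real (F_D D (2 * n + 1)) powr (- s)) \<and> Z_odd D s = Z_odd_cont D s"
    if "Re s > 0" for s
    using Z_odd_sums[OF eps fund_unit_norm_minus_one(2)[OF assms] D that]
    by (simp add: Z_odd_def sums_iff)
  show ?thesis
    using gamma_term_summable[OF eps] sums Z_odd_cont_holomorphic[OF eps] Z_odd_cont_simple_pole[OF eps qD]
    by blast
qed

end
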